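(* Let $\mathcal{X}$ be a topological space, $P$ a Borel probability distribution over $\mathcal{X}\times\{-1,1\}$, and $(X_t,Y_t)_{t\ge1}$ a sequence of i.i.d. observations from $P$. Let $\mathcal{F}$ be a collection of Borel-measurable functions from $\mathcal{X}$ to $\{-1,1\}$, and define $$R(f)=\mathbb{P}(f(X)\ne Y)\ \ ((X,Y)\sim P),\qquad R_t(f)=\frac1t\sum_{i=1}^tI(f(X_i)\ne Y_i),\quad f\in\mathcal{F}.$$ Let $(\epsilon_t)_{t\ge1}$ be i.i.d. Rademacher random variables independent of the data, and define $$\mathcal{R}_t(\mathcal{F})=\mathbb{E}\left[\sup_{f\in\mathcal{F}}\frac1t\Big|\sum_{i=1}^t\epsilon_if(X_i)\Big|\right],\qquad\hat{\mathcal{R}}_t(\mathcal{F})=\mathbb{E}_{\epsilon}\left[\sup_{f\in\mathcal{F}}\frac1t\Big|\sum_{i=1}^t\epsilon_if(X_i)\Big|\right],$$ where $\mathbb{E}_\epsilon$ is the expectation over $\epsilon_1,\dots,\epsilon_t$ only (with $X_1,\dots,X_t$ fixed). Let $\ell:[0,\infty)\to[1,\infty)$ satisfy $\sum_{j=1}^\infty1/\ell(j)\le1$, $\ell(x)=\ell(1)$ for all $x\in[0,1]$, and $u\mapsto2^{-u}\log\ell(u)$ decreasing (not necessarily strictly) on $[1,\infty)$. Let $\delta\in(0,1)$ and $\bar t=\lceil t/2\rceil$ for integers $t\ge1$. Then: 1. $$\mathbb{P}\left(\forall t\ge1:\sup_{f\in\mathcal{F}}|R_t(f)-R(f)|\le\mathcal{R}_{\bar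 t}(\mathcal{F})+2\sqrt{\frac2t\Big[\log\ell(\log_2t)+\log(1/\delta)\Big]}\right)\ge1-\delta.$$ 2. $(\hat{\mathcal{R}}_t(\mathcal{F}))_{t\ge1}$ is a reverse submartingale with respect to the exchangeable filtration $(\mathcal{E}_t^X)$, and $$\mathbb{P}\left(\forall t\ge1:\mathcal{R}_{\bar t}(\mathcal{F})\ge\hat{\mathcal{R}}_t(\mathcal{F})-4\sqrt{\frac2t\Big[\log\ell(\log_2t)+\log(1/\delta)\Big]}\right)\ge1-\delta.$$
   Context: Rademacher random variables take values $\pm1$ with probability $1/2$ each. $\mathcal{E}^X_t$ is the $\sigma$-algebra generated by all real-valued Borel-measurable functions of $X_1,X_2,\dots$ which are permutation-symmetric in their first $t$ arguments. A reverse submartingale with respect to a nonincreasing sequence of $\sigma$-algebras $(\mathcal{F}_t)$ is an integrable process with $R_t$ $\mathcal{F}_t$-measurable and $\mathbb{E}[R_t\mid\mathcal{F}_{t+1}]\ge R_{t+1}$ a.s. for all $t\ge1$. Measurability convention: the suprema over $\mathcal{F}$ above are assumed to be measurable functions of the samples (and of the Rademacher variables). *)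

theory Defs
  imports "HOL-Probability.Probability"
begin

text \<open>Sequences are indexed by \<open>{1..}\<close>. The Borel \<open>\<sigma>\<close>-algebra of the subspace
  \<open>\<X> \<times> {-1, 1}\<close> of the topological product \<open>\<X> \<times> \<real>\<close>:\<close>

definition labelled_borel :: "('x::topological_space \<times> real) measure" where
  "labelled_borel = restrict_space borel (UNIV \<times> {-1, 1})"

definition iid_sequence :: "'a measure \<Rightarrow> 'b measure \<Rightarrow> (nat \<Rightarrow> 'a \<Rightarrow> 'b) \<Rightarrow> bool" where
  "iid_sequence M D Z \<longleftrightarrow>
     prob_space.indep_vars M (\<lambda>_. D) Z {1..} \<and> (\<forall>i\<ge>1. distr M D (Z i) = D)"

definition sequence_algebra :: "'a measure \<Rightarrow> 'b measure \<Rightarrow> (nat \<Rightarrow> 'a \<Rightarrow> 'b) \<Rightarrow> 'a measure" where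
  "sequence_algebra M D Z =
     vimage_algebra (space M) (\<lambda>\<omega>. \<lambda>i\<in>{1..}. Z i \<omega>) (Pi\<^sub>M {1..} (\<lambda>_. D))"

text \<open>The values are \<open>\<plusminus>1\<close> almost surely, but not necessarily on all of \<open>space M\<close>.\<close>

definition rademacher :: "'a measure \<Rightarrow> ('a \<Rightarrow> real) \<Rightarrow> bool" where
  "rademacher M e \<longleftrightarrow> e \<in> borel_measurable M \<and>
     measure M {\<omega> \<in> space M. e \<omega> = 1} = 1 / 2 \<and>
     measure M {\<omega> \<in> space M. e \<omega> = -1} = 1 / 2"

definition risk :: "('x \<times> real) measure \<Rightarrow> ('x \<Rightarrow> real) \<Rightarrow> real" where
  "risk P f = measure P {z \<in> space P. f (fst z) \<noteq> snd z}"

definition emp_risk :: "nat \<Rightarrow> (nat \<Rightarrow> 'x \<times> real) \<Rightarrow> ('x \<Rightarrow> real) \<Rightarrow> real" where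
  "emp_risk t z f = 1 / real t * (\<Sum>i=1..t. of_bool (f (fst (z i)) \<noteq> snd (z i)))"

definition sup_risk_deviation ::
    "('x \<times> real) measure \<Rightarrow> ('x \<Rightarrow> real) set \<Rightarrow> nat \<Rightarrow> (nat \<Rightarrow> 'x \<times> real) \<Rightarrow> real" where
  "sup_risk_deviation P F t z = (SUP f\<in>F. \<bar>emp_risk t z f - risk P f\<bar>)"

definition rademacher_sup ::
    "('x \<Rightarrow> real) set \<Rightarrow> nat \<Rightarrow> (nat \<Rightarrow> real) \<Rightarrow> (nat \<Rightarrow> 'x) \<Rightarrow> real" where
  "rademacher_sup F t e x = (SUP f\<in>F. 1 / real t * \<bar>\<Sum>i=1..t. e i * f (x i)\<bar>)"

definition rademacher_complexity ::
    "'a measure \<Rightarrow> (nat \<Rightarrow> 'a \<Rightarrow> real) \<Rightarrow> (nat \<Rightarrow> 'a \<Rightarrow> 'x) \<Rightarrow> ('x \<Rightarrow> real) set \<Rightarrow> nat \<Rightarrow> real" where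
  "rademacher_complexity M \<epsilon> X F t =
     (\<integral>\<omega>. rademacher_sup F t (\<lambda>i. \<epsilon> i \<omega>) (\<lambda>i. X i \<omega>) \<partial>M)"

text \<open>The data are frozen at \<open>\<omega>\<close>; the integration variable \<open>\<omega>'\<close> enters through the signs only.\<close>

definition emp_rademacher_complexity ::
    "'a measure \<Rightarrow> (nat \<Rightarrow> 'a \<Rightarrow> real) \<Rightarrow> (nat \<Rightarrow> 'a \<Rightarrow> 'x) \<Rightarrow> ('x \<Rightarrow> real) set \<Rightarrow> nat \<Rightarrow> 'a \<Rightarrow> real" where
  "emp_rademacher_complexity M \<epsilon> X F t \<omega> =
     (\<integral>\<omega>'. rademacher_sup F t (\<lambda>i. \<epsilon> i \<omega>') (\<lambda>i. X i \<omega>) \<partial>M)"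

text \<open>Functions of the whole sequence are measurable for the product \<open>\<sigma>\<close>-algebra of the Borel
  \<open>\<sigma>\<close>-algebras. For a space that is not second countable this may be smaller than the Borel
  \<open>\<sigma>\<close>-algebra of the product topology, with respect to which the sequence need not be a
  random element.\<close>

definition symmetric_functions ::
    "nat \<Rightarrow> ((nat \<Rightarrow> 'x::topological_space) \<Rightarrow> real) set" where
  "symmetric_functions t =
     {g \<in> borel_measurable (Pi\<^sub>M {1..} (\<lambda>_. borel)).
        \<forall>\<pi>. \<pi> permutes {1..t} \<longrightarrow>
          (\<forall>x \<in> space (Pi\<^sub>M {1..} (\<lambda>_. borel :: 'x measure)). g (\<lambda>i. x (\<pi> i)) = g x)}"

definition exchangeable_algebra ::
    "'a measure \<Rightarrow> (nat \<Rightarrow> 'a \<Rightarrow> 'x::topological_space) \<Rightarrow> nat \<Rightarrow> 'a measure" where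
  "exchangeable_algebra M X t =
     sigma (space M)
       {(\<lambda>\<omega>. g (\<lambda>i\<in>{1..}. X i \<omega>)) -` B \<inter> space M | g B.
          g \<in> symmetric_functions t \<and> B \<in> sets borel}"

definition reverse_submartingale ::
    "'a measure \<Rightarrow> (nat \<Rightarrow> 'a measure) \<Rightarrow> (nat \<Rightarrow> 'a \<Rightarrow> real) \<Rightarrow> bool" where
  "reverse_submartingale M \<G> S \<longleftrightarrow>
     (\<forall>t\<ge>1. subalgebra M (\<G> t) \<and> subalgebra (\<G> t) (\<G> (t + 1)) \<and>
        integrable M (S t) \<and> S t \<in> borel_measurable (\<G> t) \<and>
        (AE \<omega> in M. real_cond_exp M (\<G> (t + 1)) (S t) \<omega> \<ge> S (t + 1) \<omega>))"

definition confidence_width :: "(real \<Rightarrow> real) \<Rightarrow> real \<Rightarrow> nat \<Rightarrow> real" where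
  "confidence_width l \<delta> t =
     sqrt (2 / real t * (ln (l (log 2 (real t))) + ln (1 / \<delta>)))"

end

theory Submission
  imports Defs
begin

text \<open>Both the sup-deviation of the empirical risk and the sign-averaged Rademacher supremum are
  dominated by the average of their leave-one-out versions. For a statistic that is symmetric in the
  sample this is a reverse submartingale property, and it survives composition with the increasing
  convex function \<open>exp (l * _)\<close>. A maximal inequality then controls all \<open>t \<ge> n\<close> by the moment
  generating function at time \<open>n\<close>, which the bounded differences inequality estimates; a union bound
  over the epochs \<open>[2 ^ j, 2 ^ (j + 1))\<close> with weights \<open>1 / l (j + 1)\<close> gives the confidence sequences.
  The mean of the sup-deviation is at most the Rademacher complexity by symmetrization, and the
  complexity decreases in the sample size, so that the epoch start may be replaced by \<open>\<lceil>t / 2\<rceil>\<close>.\<close>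

section \<open>Concentration under bounded differences\<close>

text \<open>The argument runs on the canonical sequence space \<open>iid_space D\<close>, where
  permuting coordinates is a measure-preserving map; the laws of data and signs carry the results
  back to \<open>M\<close>. There the reverse submartingale property is an inequality between
  integrals over symmetric events, and conditional expectations enter only when
  \<open>reverse_submartingale\<close> itself is proved. The obstacle is measurability: of all
  suprema over the class, only \<open>sup_risk_deviation\<close> and \<open>rademacher_sup\<close>
  are known to be measurable, so the auxiliary supremum of the symmetrization has to be an instance
  of \<open>rademacher_sup\<close>. Symmetrization costs no factor 2, because the loss of a
  sign-valued classifier is \<open>(1 - y * f x) / 2\<close> and this half cancels it. Changing one
  observation moves the deviation by at most \<open>1 / t\<close> and the sign-averaged supremum by
  at most \<open>2 / t\<close>; hence the factors 2 and 4 before the width. Signs are 1 or -1 only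
  almost surely, and an empty class yields the unspecified \<open>Sup {}\<close>, so both statistics
  are bounded by \<open>max 1 \<bar>Sup {}\<bar>\<close>.\<close>

text \<open>Hoeffding's lemma with only the length of the range fixed: \<open>f\<close> takes its
  values in an interval of length \<open>c\<close> that starts at its infimum. When all other
  coordinates are frozen, the location of that interval varies with them but its length does
  not.\<close>

lemma (in prob_space) Hoeffdings_lemma_oscillation:
  fixes f :: "'a \<Rightarrow> real"
  assumes [measurable]: "f \<in> borel_measurable M"
    and osc: "\<And>x y. x \<in> space M \<Longrightarrow> y \<in> space M \<Longrightarrow> f x - f y \<le> c" and "l > 0"
  shows "expectation (\<lambda>x. exp (l * f x)) \<le> exp (l * expectation f + l\<^sup>2 * c\<^sup>2 / 8)"
proof -
  obtain x0 where x0: "x0 \<in> space M" using not_empty by blast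
  define a where "a = Inf (f ` space M)"
  have bdd: "bdd_below (f ` space M)"
    using osc[OF x0] by (intro bdd_belowI[where m="f x0 - c"]) (auto simp: algebra_simps)
  have ge: "a \<le> f x" if "x \<in> space M" for x
    unfolding a_def using bdd that by (intro cInf_lower) auto
  have "f x - c \<le> a" if "x \<in> space M" for x
    unfolding a_def using x0 osc[OF that] by (intro cInf_greatest) (auto simp: algebra_simps)
  then have le: "f x \<le> a + c" if "x \<in> space M" for x using that by fastforce
  have int: "integrable M f"
    by (intro integrable_const_bound[where B="max \<bar>a\<bar> \<bar>a + c\<bar>"])
      (use ge le in \<open>force intro!: AE_I2\<close>)+
  interpret interval_bounded_random_variable M "\<lambda>x. f x - expectation f" "a - expectation f" "a + c - expectation f"
    by unfold_locales (use ge le in \<open>auto intro!: AE_I2\<close>)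
  have int2: "integrable M (\<lambda>x. exp (l * (f x - expectation f)))"
    using ge le \<open>l > 0\<close>
    by (intro integrable_const_bound[where B="exp (l * (a + c - expectation f))"] AE_I2) auto
  have "ennreal (expectation (\<lambda>x. exp (l * (f x - expectation f)))) =
      (\<integral>\<^sup>+x. ennreal (exp (l * (f x - expectation f))) \<partial>M)"
    using int2 by (intro nn_integral_eq_integral[symmetric]) auto
  also have "\<dots> \<le> ennreal (exp (l\<^sup>2 * c\<^sup>2 / 8))"
    using Hoeffdings_lemma_nn_integral_0[OF \<open>l > 0\<close>] int by (simp add: prob_space)
  finally have "expectation (\<lambda>x. exp (l * (f x - expectation f))) \<le> exp (l\<^sup>2 * c\<^sup>2 / 8)"
    by simp
  then have "exp (l * expectation f) * expectation (\<lambda>x. exp (l * (f x - expectation f)))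
      \<le> exp (l * expectation f) * exp (l\<^sup>2 * c\<^sup>2 / 8)"
    by (intro mult_left_mono) auto
  also have "exp (l * expectation f) * expectation (\<lambda>x. exp (l * (f x - expectation f)))
      = expectation (\<lambda>x. exp (l * f x))"
    by (subst Bochner_Integration.integral_mult_right_zero[symmetric])
      (simp add: right_diff_distrib flip: exp_add)
  finally show ?thesis by (simp add: exp_add)
qed

text \<open>McDiarmid's inequality at the level of the moment generating function. Integrating one
  coordinate out gives a function \<open>?h\<close> of the remaining ones with the same bounds
  \<open>B\<close> and \<open>c\<close>, and by Hoeffding's lemma each such integration costs a
  factor \<open>exp (l\<^sup>2 * c\<^sup>2 / 8)\<close>.\<close>

lemma (in prob_space) bounded_differences_mgf:
  fixes g :: "('i \<Rightarrow> 'a) \<Rightarrow> real"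
  assumes "finite I" and "g \<in> borel_measurable (Pi\<^sub>M I (\<lambda>_. M))"
    and "\<And>x. x \<in> space (Pi\<^sub>M I (\<lambda>_. M)) \<Longrightarrow> \<bar>g x\<bar> \<le> B"
    and "\<And>x i y. x \<in> space (Pi\<^sub>M I (\<lambda>_. M)) \<Longrightarrow> i \<in> I \<Longrightarrow> y \<in> space M \<Longrightarrow> \<bar>g x - g (x(i := y))\<bar> \<le> c"
    and "l > 0"
  shows "(\<integral>x. exp (l * g x) \<partial>Pi\<^sub>M I (\<lambda>_. M))
    \<le> exp (l * (\<integral>x. g x \<partial>Pi\<^sub>M I (\<lambda>_. M)) + l\<^sup>2 * c\<^sup>2 * card I / 8)"
  using assms
proof (induction I arbitrary: g rule: finite_induct)
  case empty
  show ?case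
    by (simp add: PiM_empty lebesgue_integral_count_space_finite)
next
  case (insert i I)
  interpret PS: product_prob_space "\<lambda>_. M" I ..
  interpret Pi: prob_space "Pi\<^sub>M (insert i I) (\<lambda>_. M)" by (rule prob_space_PiM) unfold_locales
  note [measurable] = insert.prems(1)
  let ?h = "\<lambda>x. \<integral>y. g (x(i := y)) \<partial>M"
  have upd: "x(i := y) \<in> space (Pi\<^sub>M (insert i I) (\<lambda>_. M))"
    if "x \<in> space (Pi\<^sub>M I (\<lambda>_. M))" "y \<in> space M" for x y
    using that by (auto simp: space_PiM PiE_def extensional_def)
  have bd: "\<bar>g (x(i := y))\<bar> \<le> B" if "x \<in> space (Pi\<^sub>M I (\<lambda>_. M))" "y \<in> space M" for x y
    using insert.prems(2) upd that by blast
  have m: "(\<lambda>y. g (x(i := y))) \<in> borel_measurable M" if "x \<in> space (Pi\<^sub>M I (\<lambda>_. M))" for x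
    using that by measurable
  have m2: "(\<lambda>(x, y). g (x(i := y))) \<in> borel_measurable (Pi\<^sub>M I (\<lambda>_. M) \<Otimes>\<^sub>M M)"
    by measurable
  have int: "integrable M (\<lambda>y. g (x(i := y)))" if "x \<in> space (Pi\<^sub>M I (\<lambda>_. M))" for x
    using bd[OF that] m[OF that] by (intro integrable_const_bound[where B=B] AE_I2) auto
  have hm [measurable]: "?h \<in> borel_measurable (Pi\<^sub>M I (\<lambda>_. M))"
    using m2 by (intro borel_measurable_lebesgue_integral) auto
  have hB: "\<bar>?h x\<bar> \<le> B" if x: "x \<in> space (Pi\<^sub>M I (\<lambda>_. M))" for x
  proof -
    have "\<bar>?h x\<bar> \<le> (\<integral>y. \<bar>g (x(i := y))\<bar> \<partial>M)" by (rule integral_abs_bound)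
    also have "\<dots> \<le> (\<integral>y. B \<partial>M)"
      using bd[OF x] int[OF x] by (intro integral_mono) auto
    finally show ?thesis by (simp add: prob_space)
  qed
  have hc: "\<bar>?h x - ?h (x(j := z))\<bar> \<le> c"
    if x: "x \<in> space (Pi\<^sub>M I (\<lambda>_. M))" and j: "j \<in> I" and z: "z \<in> space M" for x j z
  proof -
    have x': "x(j := z) \<in> space (Pi\<^sub>M I (\<lambda>_. M))"
      using x j z by (auto simp: space_PiM PiE_def extensional_def)
    \<comment> \<open>With the updates exchanged, the two arguments of \<open>g\<close> differ by a
      single update at \<open>j\<close>, which is the form of the bounded difference
      hypothesis.\<close>
    have tw: "x(j := z, i := y) = x(i := y, j := z)" for y
      using insert.hyps j by (intro fun_upd_twist) auto
    have "?h x - ?h (x(j := z)) = (\<integral>y. g (x(i := y)) - g (x(j := z, i := y)) \<partial>M)"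
      using int[OF x] int[OF x'] by simp
    also have "\<bar>\<dots>\<bar> \<le> (\<integral>y. \<bar>g (x(i := y)) - g (x(j := z, i := y))\<bar> \<partial>M)" by (rule integral_abs_bound)
    also have "\<dots> \<le> (\<integral>y. c \<partial>M)"
    proof (rule integral_mono)
      fix y assume "y \<in> space M"
      then show "\<bar>g (x(i := y)) - g (x(j := z, i := y))\<bar> \<le> c"
        unfolding tw using j z by (intro insert.prems(3) upd x) auto
    qed (use int[OF x] int[OF x'] in auto)
    finally show ?thesis by (simp add: prob_space)
  qed
  have step: "(\<integral>y. exp (l * g (x(i := y))) \<partial>M) \<le> exp (l * ?h x + l\<^sup>2 * c\<^sup>2 / 8)"
    if x: "x \<in> space (Pi\<^sub>M I (\<lambda>_. M))" for x
  proof (rule Hoeffdings_lemma_oscillation[OF m[OF x] _ \<open>l > 0\<close>])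
    fix y z assume "y \<in> space M" "z \<in> space M"
    then have "\<bar>g (x(i := y)) - g ((x(i := y))(i := z))\<bar> \<le> c"
      by (intro insert.prems(3) upd x) auto
    then show "g (x(i := y)) - g (x(i := z)) \<le> c" by simp
  qed
  have int_exp: "integrable M (\<lambda>y. exp (l * g (x(i := y))))" if "x \<in> space (Pi\<^sub>M I (\<lambda>_. M))" for x
    using bd[OF that] m[OF that] \<open>l > 0\<close>
    by (intro integrable_const_bound[where B="exp (l * B)"] AE_I2) (auto simp: abs_le_iff)
  have int_g: "integrable (Pi\<^sub>M (insert i I) (\<lambda>_. M)) g"
    using insert.prems(2) by (intro Pi.integrable_const_bound[where B=B] AE_I2) auto
  have int_expg: "integrable (Pi\<^sub>M (insert i I) (\<lambda>_. M)) (\<lambda>x. exp (l * g x))"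
    using insert.prems(2) \<open>l > 0\<close>
    by (intro Pi.integrable_const_bound[where B="exp (l * B)"] AE_I2) (auto simp: abs_le_iff)
  have Eg: "(\<integral>x. g x \<partial>Pi\<^sub>M (insert i I) (\<lambda>_. M)) = (\<integral>x. ?h x \<partial>Pi\<^sub>M I (\<lambda>_. M))"
    using insert.hyps int_g by (intro PS.product_integral_insert) auto
  have "(\<integral>x. exp (l * g x) \<partial>Pi\<^sub>M (insert i I) (\<lambda>_. M))
      = (\<integral>x. (\<integral>y. exp (l * g (x(i := y))) \<partial>M) \<partial>Pi\<^sub>M I (\<lambda>_. M))"
    using insert.hyps int_expg by (intro PS.product_integral_insert) auto
  also have "\<dots> \<le> (\<integral>x. exp (l * ?h x + l\<^sup>2 * c\<^sup>2 / 8) \<partial>Pi\<^sub>M I (\<lambda>_. M))"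
  proof (rule integral_mono')
    show "integrable (Pi\<^sub>M I (\<lambda>_. M)) (\<lambda>x. exp (l * ?h x + l\<^sup>2 * c\<^sup>2 / 8))"
      using hB \<open>l > 0\<close>
      by (intro PS.P.integrable_const_bound[where B="exp (l * B + l\<^sup>2 * c\<^sup>2 / 8)"] AE_I2) (auto simp: abs_le_iff)
  qed (use step in auto)
  also have "\<dots> = exp (l\<^sup>2 * c\<^sup>2 / 8) * (\<integral>x. exp (l * ?h x) \<partial>Pi\<^sub>M I (\<lambda>_. M))"
    by (simp add: exp_add mult.commute)
  also have "\<dots> \<le> exp (l\<^sup>2 * c\<^sup>2 / 8) * exp (l * (\<integral>x. ?h x \<partial>Pi\<^sub>M I (\<lambda>_. M)) + l\<^sup>2 * c\<^sup>2 * card I / 8)"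
    by (rule mult_left_mono[OF insert.IH[OF hm hB hc \<open>l > 0\<close>]]) auto
  also have "\<dots> = exp (l * (\<integral>x. g x \<partial>Pi\<^sub>M (insert i I) (\<lambda>_. M)) + l\<^sup>2 * c\<^sup>2 * card (insert i I) / 8)"
    unfolding Eg using insert.hyps by (simp add: field_simps flip: exp_add)
  finally show ?case .
qed

section \<open>Symmetric statistics of i.i.d. sequences\<close>

declare One_nat_def [simp del]

abbreviation iid_space :: "'b measure \<Rightarrow> (nat \<Rightarrow> 'b) measure" where
  "iid_space D \<equiv> Pi\<^sub>M {1..} (\<lambda>_. D)"

lemma space_iid_spaceD: "x \<in> space (iid_space D) \<Longrightarrow> i \<ge> 1 \<Longrightarrow> x i \<in> space D"
  by (auto simp: space_PiM PiE_def Pi_def)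

text \<open>Points of the product space are \<open>undefined\<close> at index 0. A permutation of
  \<open>{1..t}\<close> fixes 0, so reindexing respects this default value and needs no restriction;
  the restricted form is the one to which product measurability applies.\<close>

lemma permute_in_iid_space:
  assumes "\<pi> permutes {1..t}" and x: "x \<in> space (iid_space D)"
  shows "(\<lambda>i. x (\<pi> i)) \<in> space (iid_space D)"
    and "(\<lambda>i. x (\<pi> i)) = (\<lambda>i\<in>{1..}. x (\<pi> i))"
proof -
  have \<pi>: "\<pi> i \<ge> 1" if "i \<ge> 1" for i
    using permutes_in_image[OF assms(1), of i] permutes_not_in[OF assms(1), of i] that by fastforce
  have 0: "\<pi> 0 = 0" using assms(1) by (auto simp: permutes_def)
  have "x 0 = undefined" using x by (auto simp: space_PiM PiE_def extensional_def)
  with 0 show "(\<lambda>i. x (\<pi> i)) = (\<lambda>i\<in>{1..}. x (\<pi> i))"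
    by (auto simp: fun_eq_iff restrict_def not_le One_nat_def)
  moreover have "(\<lambda>i\<in>{1..}. x (\<pi> i)) \<in> space (iid_space D)"
    using \<pi> space_iid_spaceD[OF x] by (auto simp: space_PiM)
  ultimately show "(\<lambda>i. x (\<pi> i)) \<in> space (iid_space D)" by simp
qed

lemma permutes_mono: "\<pi> permutes {1..t} \<Longrightarrow> t \<le> s \<Longrightarrow> \<pi> permutes {1..s::nat}"
  by (rule permutes_subset) auto

lemma measurable_permute:
  assumes "\<pi> permutes {1..t}"
  shows "(\<lambda>x i. x (\<pi> i)) \<in> iid_space D \<rightarrow>\<^sub>M iid_space D"
proof (subst measurable_cong[OF permute_in_iid_space(2)[OF assms]])
  have "\<pi> i \<ge> 1" if "i \<ge> 1" for i
    using permutes_in_image[OF assms(1), of i] permutes_not_in[OF assms(1), of i] that by fastforce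
  then show "(\<lambda>x. \<lambda>i\<in>{1..}. x (\<pi> i)) \<in> iid_space D \<rightarrow>\<^sub>M iid_space D"
    by (intro measurable_restrict measurable_component_singleton) auto
qed

text \<open>Exchangeability of an i.i.d. sequence: an injective reindexing of identical factors
  preserves the product measure.\<close>

lemma (in prob_space) distr_permute:
  assumes "\<pi> permutes {1..t}"
  shows "distr (iid_space M) (iid_space M) (\<lambda>x i. x (\<pi> i)) = iid_space M"
proof -
  have \<pi>: "\<pi> i \<ge> 1" if "i \<ge> 1" for i
    using permutes_in_image[OF assms(1), of i] permutes_not_in[OF assms(1), of i] that by fastforce
  have "distr (iid_space M) (iid_space M) (\<lambda>x. \<lambda>i\<in>{1..}. x (\<pi> i)) = iid_space M"
    using \<pi> permutes_inj_on[OF assms] by (intro distr_PiM_reindex) (auto intro: prob_space_axioms)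
  then show ?thesis
    by (subst distr_cong[OF refl refl permute_in_iid_space(2)[OF assms]]) auto
qed

lemma (in prob_space) integral_permute:
  fixes f :: "(nat \<Rightarrow> 'a) \<Rightarrow> real"
  assumes \<pi>: "\<pi> permutes {1..t}" and [measurable]: "f \<in> borel_measurable (iid_space M)"
  shows "(\<integral>x. f (\<lambda>i. x (\<pi> i)) \<partial>iid_space M) = (\<integral>x. f x \<partial>iid_space M)"
  using integral_distr[OF measurable_permute[OF \<pi>] assms(2)] by (simp add: distr_permute[OF \<pi>])

lemma measurable_restrict_iid:
  "1 \<le> k \<Longrightarrow> (\<lambda>x. restrict x {k..n}) \<in> iid_space D \<rightarrow>\<^sub>M Pi\<^sub>M {k..n} (\<lambda>_. D)"
  by (rule measurable_restrict_subset) auto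

lemma (in prob_space) distr_restrict_iid:
  "distr (iid_space M) (Pi\<^sub>M {1..n} (\<lambda>_. M)) (\<lambda>x. restrict x {1..n}) = Pi\<^sub>M {1..n} (\<lambda>_. M)"
  using distr_PiM_reindex[of "{1..}" "\<lambda>_. M" id "{1..n}"] prob_space_axioms
  by (simp add: restrict_def)

lemma (in prob_space) integral_restrict_iid:
  fixes f :: "(nat \<Rightarrow> 'a) \<Rightarrow> real"
  assumes [measurable]: "f \<in> borel_measurable (Pi\<^sub>M {1..n} (\<lambda>_. M))"
  shows "(\<integral>x. f (restrict x {1..n}) \<partial>iid_space M) = (\<integral>x. f x \<partial>Pi\<^sub>M {1..n} (\<lambda>_. M))"
  using integral_distr[OF measurable_restrict_iid[of 1 n M] assms] by (simp add: distr_restrict_iid)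

text \<open>The counterpart of the exchangeable algebra on the canonical sequence space. Integrals
  over these events replace conditioning on that algebra.\<close>

definition symmetric_event :: "'b measure \<Rightarrow> nat \<Rightarrow> (nat \<Rightarrow> 'b) set \<Rightarrow> bool" where
  "symmetric_event D t A \<longleftrightarrow> A \<in> sets (iid_space D) \<and>
     (\<forall>\<pi>. \<pi> permutes {1..t} \<longrightarrow> (\<forall>x\<in>space (iid_space D). (\<lambda>i. x (\<pi> i)) \<in> A \<longleftrightarrow> x \<in> A))"

lemma symmetric_eventD:
  assumes "symmetric_event D t A"
  shows "A \<in> sets (iid_space D)"
    and "\<pi> permutes {1..t} \<Longrightarrow> x \<in> space (iid_space D) \<Longrightarrow> (\<lambda>i. x (\<pi> i)) \<in> A \<longleftrightarrow> x \<in> A"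
  using assms by (auto simp: symmetric_event_def)

lemma symmetric_event_mono: "symmetric_event D t A \<Longrightarrow> s \<le> t \<Longrightarrow> symmetric_event D s A"
  unfolding symmetric_event_def using permutes_mono by blast

section \<open>Maximal inequality and confidence sequences for leave-one-out dominated
  statistics\<close>

text \<open>What the risk deviation and the sign-averaged supremum have in common, in a form that
  passes to \<open>exp (l * S t x)\<close>. On the indices \<open>1..t\<close>, the transposition of
  \<open>i\<close> with \<open>Suc t\<close> runs through all of \<open>1..Suc t\<close> except
  \<open>i\<close>, so \<open>le_average\<close> compares \<open>S (Suc t)\<close> with the mean
  over the samples that lack one point.\<close>

locale leave_one_out = prob_space D for D :: "'b measure" +
  fixes S :: "nat \<Rightarrow> (nat \<Rightarrow> 'b) \<Rightarrow> real" and B :: real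
  assumes measurable_prefix: "\<And>t. t \<ge> 1 \<Longrightarrow> S t \<in> borel_measurable (Pi\<^sub>M {1..t} (\<lambda>_. D))"
    and bounded: "\<And>t x. t \<ge> 1 \<Longrightarrow> \<bar>S t x\<bar> \<le> B"
    and prefix_only: "\<And>t x. t \<ge> 1 \<Longrightarrow> S t (restrict x {1..t}) = S t x"
    and symmetric: "\<And>t \<pi> x. t \<ge> 1 \<Longrightarrow> \<pi> permutes {1..t} \<Longrightarrow> S t (\<lambda>i. x (\<pi> i)) = S t x"
    and le_average: "\<And>t x. t \<ge> 1 \<Longrightarrow>
      S (Suc t) x \<le> (\<Sum>i=1..Suc t. S t (\<lambda>j. x (Transposition.transpose i (Suc t) j))) / real (Suc t)"
begin

sublocale Q: prob_space "iid_space D"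
  by (rule prob_space_PiM) unfold_locales

lemma prefix_cong: "t \<ge> 1 \<Longrightarrow> (\<And>i. i \<in> {1..t} \<Longrightarrow> x i = y i) \<Longrightarrow> S t x = S t y"
  by (metis prefix_only restrict_ext)

lemma measurable_iid: "t \<ge> 1 \<Longrightarrow> S t \<in> borel_measurable (iid_space D)"
  using measurable_compose[OF measurable_restrict_iid[of 1 t D] measurable_prefix[of t]] by (simp add: prefix_only)

lemma integrable_iid: "t \<ge> 1 \<Longrightarrow> integrable (iid_space D) (S t)"
  using bounded measurable_iid by (intro Q.integrable_const_bound[where B=B] AE_I2) auto

lemma integrable_on_event:
  "t \<ge> 1 \<Longrightarrow> A \<in> sets (iid_space D) \<Longrightarrow> integrable (iid_space D) (\<lambda>x. S t x * indicator A x)"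
  using integrable_real_mult_indicator[OF _ integrable_iid] by (simp add: mult.commute)

lemma integral_prefix: "t \<ge> 1 \<Longrightarrow> (\<integral>x. S t x \<partial>Pi\<^sub>M {1..t} (\<lambda>_. D)) = (\<integral>x. S t x \<partial>iid_space D)"
  using integral_restrict_iid[OF measurable_prefix, of t] by (simp add: prefix_only)

text \<open>The reverse submartingale inequality tested on an event of the exchangeable algebra. The
  event and the law are both invariant under the transpositions, so all \<open>Suc t\<close>
  leave-one-out terms have the same integral over \<open>A\<close>, and their average is that
  integral.\<close>

lemma integral_Suc_le:
  assumes t: "t \<ge> 1" and A: "symmetric_event D (Suc t) A"
  shows "(\<integral>x. S (Suc t) x * indicator A x \<partial>iid_space D) \<le> (\<integral>x. S t x * indicator A x \<partial>iid_space D)"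
proof -
  note [measurable] = symmetric_eventD(1)[OF A] measurable_iid[OF t]
  let ?\<tau> = "\<lambda>i. Transposition.transpose i (Suc t)"
  have \<tau>: "?\<tau> i permutes {1..Suc t}" if "i \<in> {1..Suc t}" for i
    using that by (intro permutes_swap_id) auto
  \<comment> \<open>Invariance of \<open>A\<close> lets the indicator be transposed as well, so that
    the product is one function of the permuted sequence.\<close>
  have eq: "S t (\<lambda>j. x (?\<tau> i j)) * indicator A x =
      (\<lambda>y. S t y * indicator A y) (\<lambda>j. x (?\<tau> i j))"
    if "i \<in> {1..Suc t}" "x \<in> space (iid_space D)" for i x
    using symmetric_eventD(2)[OF A \<tau>[OF that(1)] that(2)] by (simp add: indicator_def)
  have int: "integrable (iid_space D) (\<lambda>x. S t (\<lambda>j. x (?\<tau> i j)) * indicator A x)"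
    if i: "i \<in> {1..Suc t}" for i
  proof (intro Q.integrable_const_bound[where B=B] AE_I2)
    show "(\<lambda>x. S t (\<lambda>j. x (?\<tau> i j)) * indicator A x) \<in> borel_measurable (iid_space D)"
      using measurable_compose[OF measurable_permute[OF \<tau>[OF i]] measurable_iid[OF t]] by measurable
    show "norm (S t (\<lambda>j. x (?\<tau> i j)) * indicator A x) \<le> B" for x
      using bounded[OF t, of "\<lambda>j. x (?\<tau> i j)"] by (auto simp: indicator_def)
  qed
  have "(\<integral>x. S (Suc t) x * indicator A x \<partial>iid_space D)
      \<le> (\<integral>x. (\<Sum>i=1..Suc t. S t (\<lambda>j. x (?\<tau> i j)) * indicator A x) / real (Suc t) \<partial>iid_space D)"
  proof (rule integral_mono)
    show "S (Suc t) x * indicator A x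
        \<le> (\<Sum>i=1..Suc t. S t (\<lambda>j. x (?\<tau> i j)) * indicator A x) / real (Suc t)" for x
      using le_average[OF t, of x] by (cases "x \<in> A") auto
  qed (intro Bochner_Integration.integrable_divide Bochner_Integration.integrable_sum int
      integrable_on_event symmetric_eventD(1)[OF A]; simp)+
  also have "\<dots> = (\<Sum>i=1..Suc t. \<integral>x. S t (\<lambda>j. x (?\<tau> i j)) * indicator A x \<partial>iid_space D) / real (Suc t)"
    using int by (subst integral_divide_zero, subst Bochner_Integration.integral_sum) auto
  also have "(\<Sum>i=1..Suc t. \<integral>x. S t (\<lambda>j. x (?\<tau> i j)) * indicator A x \<partial>iid_space D)
      = (\<Sum>i=1..Suc t. \<integral>x. S t x * indicator A x \<partial>iid_space D)"
  proof (rule sum.cong[OF refl])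
    fix i assume i: "i \<in> {1..Suc t}"
    show "(\<integral>x. S t (\<lambda>j. x (?\<tau> i j)) * indicator A x \<partial>iid_space D)
        = (\<integral>x. S t x * indicator A x \<partial>iid_space D)"
      unfolding integral_permute[OF \<tau>[OF i], of "\<lambda>x. S t x * indicator A x", simplified, symmetric]
      by (rule Bochner_Integration.integral_cong) (use eq i in auto)
  qed
  finally show ?thesis by simp
qed

lemma integral_antimono:
  assumes "1 \<le> n" "n \<le> t" "symmetric_event D t A"
  shows "(\<integral>x. S t x * indicator A x \<partial>iid_space D) \<le> (\<integral>x. S n x * indicator A x \<partial>iid_space D)"
  using assms(2,3)
proof (induction t rule: dec_induct)
  case (step t)
  then show ?case
    using integral_Suc_le[of t A] symmetric_event_mono[of D "Suc t" A t] \<open>1 \<le> n\<close> by force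
qed simp

lemma expectation_antimono:
  assumes "1 \<le> n" "n \<le> t"
  shows "(\<integral>x. S t x \<partial>iid_space D) \<le> (\<integral>x. S n x \<partial>iid_space D)"
proof -
  have "symmetric_event D t (space (iid_space D))"
    using permute_in_iid_space(1) by (auto simp: symmetric_event_def)
  from integral_antimono[OF assms this] show ?thesis
    by (simp add: indicator_def cong: Bochner_Integration.integral_cong)
qed

text \<open>The last index in \<open>{n..T}\<close> at which the level \<open>a\<close> is exceeded plays the role of a stopping
  time: the event that it equals \<open>t\<close> is symmetric in the first \<open>t\<close> arguments.\<close>

lemma finite_maximal_inequality:
  assumes nn: "\<And>t x. 0 \<le> S t x" and n: "1 \<le> n"
  shows "a * Q.prob {x \<in> space (iid_space D). \<exists>t\<in>{n..T}. a \<le> S t x} \<le> (\<integral>x. S n x \<partial>iid_space D)"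
proof -
  let ?Q = "iid_space D"
  define A where "A t = {x \<in> space ?Q. a \<le> S t x \<and> (\<forall>s\<in>{t<..T}. S s x < a)}" for t
  have A_sets [measurable]: "A t \<in> sets ?Q" if "t \<in> {n..T}" for t
  proof -
    have "S s \<in> borel_measurable ?Q" if "s = t \<or> s \<in> {t<..T}" for s
      using that \<open>t \<in> {n..T}\<close> n by (intro measurable_iid) auto
    then show ?thesis unfolding A_def
      by (intro sets.sets_Collect sets.sets_Collect_finite_All borel_measurable_le borel_measurable_less) auto
  qed
  have A_sym: "symmetric_event D t (A t)" if "t \<in> {n..T}" for t
    unfolding symmetric_event_def
  proof safe
    fix \<pi> x assume \<pi>: "\<pi> permutes {1..t}" and x: "x \<in> space ?Q"
    \<comment> \<open>Looking forward from \<open>t\<close> preserves symmetry: a permutation of the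
      first \<open>t\<close> indices is also one of the first \<open>s\<close>.\<close>
    have "S s (\<lambda>i. x (\<pi> i)) = S s x" if "t \<le> s" for s
      using symmetric[OF _ permutes_mono[OF \<pi> that]] that \<open>t \<in> _\<close> n by simp
    then show "(\<lambda>i. x (\<pi> i)) \<in> A t \<Longrightarrow> x \<in> A t" "x \<in> A t \<Longrightarrow> (\<lambda>i. x (\<pi> i)) \<in> A t"
      using x permute_in_iid_space(1)[OF \<pi> x] by (auto simp: A_def)
  qed (use that A_sets in auto)
  have "x \<in> (\<Union>t\<in>{n..T}. A t)" if x: "x \<in> space ?Q" and ex: "\<exists>t\<in>{n..T}. a \<le> S t x" for x
  proof -
    define t where "t = Max {t\<in>{n..T}. a \<le> S t x}"
    have "t \<in> {t\<in>{n..T}. a \<le> S t x}" unfolding t_def by (rule Max_in) (use ex in auto)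
    moreover have "S s x < a" if "s \<in> {t<..T}" for s
    proof (rule ccontr)
      assume "\<not> S s x < a"
      then have "s \<le> t" unfolding t_def using that \<open>t \<in> _\<close> by (intro Max_ge) auto
      then show False using that by auto
    qed
    ultimately show ?thesis using x by (auto simp: A_def)
  qed
  then have union: "{x \<in> space ?Q. \<exists>t\<in>{n..T}. a \<le> S t x} = (\<Union>t\<in>{n..T}. A t)"
    by (auto simp: A_def)
  have disj: "disjoint_family_on A {n..T}"
    unfolding disjoint_family_on_def A_def by (auto, metis greaterThanAtMost_iff linorder_neqE_nat not_less)
  have "a * Q.prob (\<Union>t\<in>{n..T}. A t) = (\<Sum>t\<in>{n..T}. a * Q.prob (A t))"
    using A_sets disj by (subst Q.finite_measure_finite_Union) (auto simp: sum_distrib_left)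
  also have "\<dots> \<le> (\<Sum>t\<in>{n..T}. \<integral>x. S n x * indicator (A t) x \<partial>?Q)"
  proof (rule sum_mono)
    fix t assume t: "t \<in> {n..T}"
    have "a * Q.prob (A t) = (\<integral>x. a * indicator (A t) x \<partial>?Q)"
      using A_sets[OF t] by simp
    also have "\<dots> \<le> (\<integral>x. S t x * indicator (A t) x \<partial>?Q)"
      using t n A_sets[OF t]
      by (intro integral_mono integrable_on_event integrable_mult_right integrable_real_indicator)
        (auto simp: A_def indicator_def less_top[symmetric])
    \<comment> \<open>Symmetry of \<open>A t\<close> at time \<open>t\<close> is what allows the
      descent from \<open>t\<close> to \<open>n\<close> on this event; the disjoint pieces then add
      up under the single integrand \<open>S n\<close>.\<close>
    also have "\<dots> \<le> (\<integral>x. S n x * indicator (A t) x \<partial>?Q)"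
      using t n A_sym by (intro integral_antimono) auto
    finally show "a * Q.prob (A t) \<le> (\<integral>x. S n x * indicator (A t) x \<partial>?Q)" .
  qed
  also have "\<dots> = (\<integral>x. (\<Sum>t\<in>{n..T}. S n x * indicator (A t) x) \<partial>?Q)"
    using n A_sets by (subst Bochner_Integration.integral_sum) (auto intro: integrable_on_event)
  also have "\<dots> \<le> (\<integral>x. S n x \<partial>?Q)"
  proof (rule integral_mono)
    show "integrable ?Q (\<lambda>x. \<Sum>t\<in>{n..T}. S n x * indicator (A t) x)"
      using n A_sets by (intro Bochner_Integration.integrable_sum integrable_on_event) auto
    show "(\<Sum>t\<in>{n..T}. S n x * indicator (A t) x) \<le> S n x" for x
    proof -
      have "(\<Sum>t\<in>{n..T}. indicator (A t) x) = (indicator (\<Union>t\<in>{n..T}. A t) x :: real)"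
        by (subst indicator_UN_disjoint[OF _ disj]) auto
      then show ?thesis
        using nn[of n x] by (auto simp: indicator_def simp flip: sum_distrib_left)
    qed
  qed (use n integrable_iid in auto)
  finally show ?thesis unfolding union .
qed

lemma maximal_inequality:
  assumes nn: "\<And>t x. 0 \<le> S t x" and n: "1 \<le> n"
  shows "a * Q.prob {x \<in> space (iid_space D). \<exists>t\<ge>n. a \<le> S t x} \<le> (\<integral>x. S n x \<partial>iid_space D)"
proof -
  let ?A = "\<lambda>T. {x \<in> space (iid_space D). \<exists>t\<in>{n..T}. a \<le> S t x}"
  have m: "range ?A \<subseteq> sets (iid_space D)"
  proof safe
    fix T
    have [measurable]: "S t \<in> borel_measurable (iid_space D)" if "t \<in> {n..T}" for t
      using that n by (intro measurable_iid) auto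
    show "?A T \<in> sets (iid_space D)" by measurable
  qed
  have "(\<lambda>T. Q.prob (?A T)) \<longlonglongrightarrow> Q.prob (\<Union>T. ?A T)"
    by (rule Q.finite_Lim_measure_incseq[OF m]) (fastforce simp: incseq_def)
  moreover have "(\<Union>T. ?A T) = {x \<in> space (iid_space D). \<exists>t\<ge>n. a \<le> S t x}"
    by fastforce
  ultimately have "(\<lambda>T. a * Q.prob (?A T)) \<longlonglongrightarrow>
      a * Q.prob {x \<in> space (iid_space D). \<exists>t\<ge>n. a \<le> S t x}"
    by (intro tendsto_mult_left) simp
  then show ?thesis
    by (rule LIMSEQ_le_const2) (use finite_maximal_inequality[OF nn n] in auto)
qed

lemma leave_one_out_exp:
  assumes "l > 0"
  shows "leave_one_out D (\<lambda>t x. exp (l * S t x)) (exp (l * B))"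
proof unfold_locales
  fix t :: nat and x :: "nat \<Rightarrow> 'b" assume t: "t \<ge> 1"
  let ?\<tau> = "\<lambda>i j. x (Transposition.transpose i (Suc t) j)"
  show "(\<lambda>x. exp (l * S t x)) \<in> borel_measurable (Pi\<^sub>M {1..t} (\<lambda>_. D))"
    using measurable_prefix[OF t] by measurable
  show "\<bar>exp (l * S t x)\<bar> \<le> exp (l * B)"
    using bounded[OF t, of x] assms by (auto simp: abs_le_iff)
  have "exp (l * S (Suc t) x) \<le> exp (l * ((\<Sum>i=1..Suc t. S t (?\<tau> i)) / real (Suc t)))"
    using le_average[OF t, of x] assms by (intro exp_mono mult_left_mono) auto
  \<comment> \<open>The average becomes a convex combination with equal weights, ready for Jensen's
    inequality.\<close>
  also have "\<dots> = exp (l * (\<Sum>i=1..Suc t. (1 / real (Suc t)) *\<^sub>R S t (?\<tau> i)))"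
    by (simp only: sum_divide_distrib real_scaleR_def) simp
  also have "\<dots> \<le> (\<Sum>i=1..Suc t. (1 / real (Suc t)) * exp (l * S t (?\<tau> i)))"
    using assms by (intro convex_on_sum[OF _ _ convex_on_exp]) auto
  also have "\<dots> = (\<Sum>i=1..Suc t. exp (l * S t (?\<tau> i))) / real (Suc t)"
    by (simp only: sum_divide_distrib) simp
  finally show "exp (l * S (Suc t) x) \<le> (\<Sum>i=1..Suc t. exp (l * S t (?\<tau> i))) / real (Suc t)" .
qed (auto simp: prefix_only symmetric)

text \<open>A Chernoff bound in which the maximal inequality takes the place of Markov's: all times
  from \<open>n\<close> on together satisfy the bound that McDiarmid's inequality gives for time
  \<open>n\<close> alone.\<close>

lemma uniform_tail_bound:
  assumes n: "1 \<le> n" and "u > 0" "c > 0"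
    and bd: "\<And>x i y. x \<in> space (Pi\<^sub>M {1..n} (\<lambda>_. D)) \<Longrightarrow> i \<in> {1..n} \<Longrightarrow> y \<in> space D \<Longrightarrow>
      \<bar>S n x - S n (x(i := y))\<bar> \<le> c / real n"
  shows "Q.prob {x \<in> space (iid_space D). \<exists>t\<ge>n. (\<integral>x. S n x \<partial>iid_space D) + u \<le> S t x}
    \<le> exp (- 2 * real n * u\<^sup>2 / c\<^sup>2)"
proof -
  let ?E = "\<integral>x. S n x \<partial>iid_space D"
  \<comment> \<open>The minimizer of the exponent
    \<open>l\<^sup>2 * c\<^sup>2 / (8 * n) - l * u\<close>.\<close>
  define l where "l = 4 * real n * u / c\<^sup>2"
  have l: "l > 0" unfolding l_def using assms by simp
  interpret e: leave_one_out D "\<lambda>t x. exp (l * S t x)" "exp (l * B)"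
    by (rule leave_one_out_exp[OF l])
  have "exp (l * (?E + u)) * Q.prob {x \<in> space (iid_space D). \<exists>t\<ge>n. exp (l * (?E + u)) \<le> exp (l * S t x)}
      \<le> (\<integral>x. exp (l * S n x) \<partial>iid_space D)"
    using n by (intro e.maximal_inequality) auto
  also have "\<dots> = (\<integral>x. exp (l * S n x) \<partial>Pi\<^sub>M {1..n} (\<lambda>_. D))"
    using e.integral_prefix n by simp
  also have "\<dots> \<le> exp (l * (\<integral>x. S n x \<partial>Pi\<^sub>M {1..n} (\<lambda>_. D)) + l\<^sup>2 * (c / real n)\<^sup>2 * card {1..n} / 8)"
    using n by (intro bounded_differences_mgf[OF _ measurable_prefix bounded bd l]) auto
  also have "\<dots> = exp (l * (?E + u)) * exp (- 2 * real n * u\<^sup>2 / c\<^sup>2)"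
  proof -
    have "l\<^sup>2 * (c / real n)\<^sup>2 * real n / 8 = l * u - 2 * real n * u\<^sup>2 / c\<^sup>2"
      unfolding l_def using n \<open>c > 0\<close> by (simp add: field_simps power2_eq_square)
    then show ?thesis using n by (simp add: integral_prefix algebra_simps flip: exp_add)
  qed
  finally show ?thesis using l by simp
qed

lemma confidence_event: "{x \<in> space (iid_space D). \<forall>t\<ge>1. S t x \<le> b t} \<in> sets (iid_space D)"
proof -
  have [measurable]: "S t \<in> borel_measurable (iid_space D)" if "t \<in> {1..}" for t
    using that by (intro measurable_iid) auto
  have "{x \<in> space (iid_space D). \<forall>t\<in>{1..}. S t x \<le> b t} \<in> sets (iid_space D)" by measurable
  then show ?thesis by simp
qed

text \<open>Each epoch \<open>[2 ^ j, 2 ^ (j + 1))\<close> is handled by \<open>uniform_tail_bound\<close> started at \<open>2 ^ j\<close> and is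
  charged the failure probability \<open>\<delta> / l (j + 1)\<close>.\<close>

lemma confidence_sequence:
  fixes l :: "real \<Rightarrow> real"
  assumes "c > 0"
    and bd: "\<And>n x i y. 1 \<le> n \<Longrightarrow> x \<in> space (Pi\<^sub>M {1..n} (\<lambda>_. D)) \<Longrightarrow> i \<in> {1..n} \<Longrightarrow> y \<in> space D \<Longrightarrow>
      \<bar>S n x - S n (x(i := y))\<bar> \<le> c / real n"
    and mean: "\<And>n t. 1 \<le> n \<Longrightarrow> n \<le> t \<Longrightarrow> t < 2 * n \<Longrightarrow> (\<integral>x. S n x \<partial>iid_space D) \<le> m t"
    and l1: "\<And>u. u \<ge> 0 \<Longrightarrow> l u \<ge> 1"
    and suml: "summable (\<lambda>j. 1 / l (real (Suc j)))" "(\<Sum>j. 1 / l (real (Suc j))) \<le> 1"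
    and l01: "\<And>u. 0 \<le> u \<Longrightarrow> u \<le> 1 \<Longrightarrow> l u = l 1"
    and anti: "antimono_on {1..} (\<lambda>u. 2 powr (- u) * ln (l u))"
    and \<delta>: "0 < \<delta>" "\<delta> < 1"
  shows "Q.prob {x \<in> space (iid_space D). \<forall>t\<ge>1. S t x \<le> m t + 2 * c * confidence_width l \<delta> t} \<ge> 1 - \<delta>"
proof -
  let ?Q = "iid_space D"
  let ?E = "\<lambda>n. \<integral>x. S n x \<partial>?Q"
  define L where "L j = ln (l (real (Suc j))) + ln (1 / \<delta>)" for j
  \<comment> \<open>The width at the epoch start: \<open>1 / 2 ^ j\<close> stands where the final
    width has \<open>2 / t\<close>, which is at least as large because
    \<open>t < 2 * 2 ^ j\<close>.\<close>
  define w where "w j = sqrt (L j / 2 ^ j)" for j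
  define A where "A j = {x \<in> space ?Q. \<exists>t\<ge>2 ^ j. ?E (2 ^ j) + 2 * c * w j \<le> S t x}" for j
  have L_pos: "L j > 0" for j
    unfolding L_def using l1[of "real (Suc j)"] \<delta> by (intro add_nonneg_pos) (auto simp: ln_div)
  have w_pos: "w j > 0" for j using L_pos by (simp add: w_def)
  have A_sets: "A j \<in> sets ?Q" for j
  proof -
    have [measurable]: "S t \<in> borel_measurable ?Q" if "t \<in> {2 ^ j..}" for t
      using that order.trans[OF one_le_power[of "2::nat" j]] by (intro measurable_iid) auto
    have "{x \<in> space ?Q. \<exists>t\<in>{2 ^ j..}. ?E (2 ^ j) + 2 * c * w j \<le> S t x} \<in> sets ?Q" by measurable
    then show ?thesis by (simp add: A_def Bex_def)
  qed
  have prob_A: "Q.prob (A j) \<le> \<delta> * (1 / l (real (Suc j)))" for j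
  proof -
    have "Q.prob (A j) \<le> exp (- 2 * real (2 ^ j) * (2 * c * w j)\<^sup>2 / c\<^sup>2)"
      unfolding A_def using \<open>c > 0\<close> w_pos bd[of "2 ^ j"] by (intro uniform_tail_bound) auto
    also have "- 2 * real (2 ^ j) * (2 * c * w j)\<^sup>2 / c\<^sup>2 = - 8 * L j"
      using \<open>c > 0\<close> L_pos[of j] by (simp add: w_def power_mult_distrib)
    \<comment> \<open>The deviation \<open>2 * c * w j\<close> gives the exponent
      \<open>2 * 2 ^ j * 4 * L j / 2 ^ j\<close>; the choice of \<open>L\<close> makes
      \<open>exp (- L j)\<close> exactly the share of \<open>\<delta>\<close> charged to the
      epoch.\<close>
    also have "exp (- 8 * L j) \<le> exp (- L j)" using L_pos[of j] by simp
    also have "exp (- L j) = \<delta> * (1 / l (real (Suc j)))"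
      using l1[of "real (Suc j)"] \<delta> by (simp add: L_def exp_minus exp_add ln_div exp_diff field_simps)
    finally show ?thesis .
  qed
  have sumA: "summable (\<lambda>j. Q.prob (A j))"
    by (rule summable_comparison_test'[OF summable_mult[OF suml(1), of \<delta>], of 0]) (use prob_A in auto)
  have "Q.prob (\<Union>j. A j) \<le> (\<Sum>j. Q.prob (A j))"
    using A_sets sumA by (intro Q.finite_measure_subadditive_countably) auto
  also have "\<dots> \<le> (\<Sum>j. \<delta> * (1 / l (real (Suc j))))"
    by (intro suminf_le prob_A sumA summable_mult suml)
  also have "\<dots> = \<delta> * (\<Sum>j. 1 / l (real (Suc j)))" by (rule suminf_mult[OF suml(1)])
  also have "\<dots> \<le> \<delta>" using suml(2) \<delta> by simp
  finally have UA: "Q.prob (\<Union>j. A j) \<le> \<delta>" .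
  have width: "w j \<le> confidence_width l \<delta> t" if j: "2 ^ j \<le> t" "t < 2 ^ Suc j" for j t
  proof -
    have t: "t > 0" using j(1) by (metis gr0I le_zero_eq power_not_zero zero_neq_numeral)
    have rt: "real t \<ge> 2 ^ j" "real t \<le> 2 * 2 ^ j"
      using j of_nat_mono[of "2 ^ j" t] of_nat_mono[of t "2 ^ Suc j"] by auto
    then have frac: "1 / 2 ^ j \<le> 2 / real t" using t by (simp add: field_simps)
    \<comment> \<open>This compares \<open>2 powr (- u) * ln (l u)\<close> at
      \<open>u = log 2 t\<close> and at the larger \<open>u = j + 1\<close>. Both points must lie in
      \<open>{1..}\<close>, so the first epoch is treated apart.\<close>
    have "ln (l (real (Suc j))) / 2 ^ j \<le> 2 / real t * ln (l (log 2 (real t)))"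
    proof (cases j)
      \<comment> \<open>Here \<open>t = 1\<close> and the width evaluates \<open>l\<close> at
        \<open>log 2 1 = 0\<close>, below the range of monotonicity; constancy of \<open>l\<close>
        on the unit interval replaces it.\<close>
      case 0
      then have "t = 1" using j by simp
      then show ?thesis using 0 l01[of 0] l1[of 1] by simp
    next
      case (Suc k)
      have "real j \<le> log 2 (real t)" using le_log2_of_power[OF j(1)] by simp
      then have 1: "log 2 (real t) \<ge> 1" using Suc by simp
      have "log 2 (real t) \<le> log 2 (2 ^ Suc j)" using rt t by (subst log_le_cancel_iff) auto
      then have 2: "log 2 (real t) \<le> real (Suc j)" by (subst (asm) log_pow_cancel) auto
      have "2 powr (- real (Suc j)) * ln (l (real (Suc j)))
          \<le> 2 powr (- log 2 (real t)) * ln (l (log 2 (real t)))"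
        using monotone_onD[OF anti _ _ 2] 1 by auto
      also have "2 powr (- log 2 (real t)) = 1 / real t"
        using t by (simp add: powr_minus_divide)
      also have "2 powr (- real (Suc j)) = 1 / (2 * 2 ^ j)"
        by (simp only: powr_minus_divide powr_realpow[of 2] zero_less_numeral power_Suc)
      finally show ?thesis by (simp add: field_simps)
    qed
    moreover have "ln (1 / \<delta>) / 2 ^ j \<le> 2 / real t * ln (1 / \<delta>)"
      using mult_right_mono[OF frac, of "ln (1 / \<delta>)"] \<delta> by (simp add: ln_div)
    ultimately show ?thesis
      unfolding w_def confidence_width_def L_def
      by (intro real_sqrt_le_mono) (simp add: add_divide_distrib distrib_left)
  qed
  have "space ?Q - (\<Union>j. A j)
      \<subseteq> {x \<in> space ?Q. \<forall>t\<ge>1. S t x \<le> m t + 2 * c * confidence_width l \<delta> t}"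
  proof safe
    fix x and t :: nat assume x: "x \<in> space ?Q" "x \<notin> (\<Union>j. A j)" and t: "t \<ge> 1"
    obtain j where j: "2 ^ j \<le> t" "t < 2 ^ Suc j"
      using ex_power_ivl1[of 2 t] t unfolding Suc_eq_plus1 by auto
    have "S t x < ?E (2 ^ j) + 2 * c * w j"
      using x j(1) by (force simp: A_def)
    also have "\<dots> \<le> m t + 2 * c * confidence_width l \<delta> t"
      using j \<open>c > 0\<close> by (intro add_mono mean mult_left_mono width) auto
    finally show "S t x \<le> m t + 2 * c * confidence_width l \<delta> t" by simp
  qed
  then have "Q.prob (space ?Q - (\<Union>j. A j))
      \<le> Q.prob {x \<in> space ?Q. \<forall>t\<ge>1. S t x \<le> m t + 2 * c * confidence_width l \<delta> t}"
    by (rule Q.finite_measure_mono[OF _ confidence_event])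
  moreover have "Q.prob (space ?Q - (\<Union>j. A j)) = 1 - Q.prob (\<Union>j. A j)"
    using A_sets by (intro Q.prob_compl) auto
  ultimately show ?thesis using UA by simp
qed

end

section \<open>Averaged Rademacher suprema\<close>

text \<open>One shape for both suprema: centred losses of labelled points give the risk deviation,
  and products over pairs of a sign and a point give \<open>rademacher_sup\<close>. Averaging and
  bounded differences are thus treated once.\<close>

definition sup_average :: "('f \<Rightarrow> 'z \<Rightarrow> real) \<Rightarrow> 'f set \<Rightarrow> nat \<Rightarrow> (nat \<Rightarrow> 'z) \<Rightarrow> real" where
  "sup_average a F t z = (SUP f\<in>F. \<bar>\<Sum>i=1..t. a f (z i)\<bar> / real t)"

text \<open>The quotient on the right is left uncancelled so that the bound also covers
  \<open>t = 0\<close>, where both sides vanish.\<close>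

lemma abs_average_le:
  assumes "\<And>f i. f \<in> F \<Longrightarrow> i \<in> {1..t} \<Longrightarrow> \<bar>a f (z i)\<bar> \<le> K" and "f \<in> F"
  shows "\<bar>\<Sum>i=1..t. a f (z i)\<bar> / real t \<le> real t * K / real t"
proof -
  have "\<bar>\<Sum>i=1..t. a f (z i)\<bar> \<le> (\<Sum>i=1..t. \<bar>a f (z i)\<bar>)" by (rule sum_abs)
  also have "\<dots> \<le> (\<Sum>i=1..t. K)" using assms by (intro sum_mono) auto
  finally show ?thesis by (intro divide_right_mono) auto
qed

lemma le_sup_average:
  assumes "\<And>f i. f \<in> F \<Longrightarrow> i \<in> {1..t} \<Longrightarrow> \<bar>a f (z i)\<bar> \<le> K" and "f \<in> F"
  shows "\<bar>\<Sum>i=1..t. a f (z i)\<bar> / real t \<le> sup_average a F t z"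
  unfolding sup_average_def
  by (rule cSUP_upper[OF assms(2) bdd_aboveI2[of _ _ "real t * K / real t"]])
    (rule abs_average_le, rule assms(1))

lemma sup_average_least:
  "F \<noteq> {} \<Longrightarrow> (\<And>f. f \<in> F \<Longrightarrow> \<bar>\<Sum>i=1..t. a f (z i)\<bar> / real t \<le> c) \<Longrightarrow> sup_average a F t z \<le> c"
  unfolding sup_average_def by (rule cSUP_least)

lemma sup_average_cong:
  "(\<And>i. i \<in> {1..t} \<Longrightarrow> z i = z' i) \<Longrightarrow> sup_average a F t z = sup_average a F t z'"
  unfolding sup_average_def
  by (intro SUP_cong refl arg_cong[where f="\<lambda>s. \<bar>s\<bar> / real t"] sum.cong) auto

lemma sup_average_permute:
  assumes "\<pi> permutes {1..t}"
  shows "sup_average a F t (\<lambda>i. z (\<pi> i)) = sup_average a F t z"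
  using sum.permute[OF assms, of "\<lambda>i. a _ (z i)"] by (simp add: sup_average_def comp_def)

text \<open>A supremum over the empty class is the unspecified real \<open>Sup {}\<close>.\<close>

lemma abs_sup_average_le:
  assumes "t \<ge> 1" and K: "\<And>f i. f \<in> F \<Longrightarrow> i \<in> {1..t} \<Longrightarrow> \<bar>a f (z i)\<bar> \<le> K"
  shows "\<bar>sup_average a F t z\<bar> \<le> max K \<bar>Sup {}\<bar>"
proof (cases "F = {}")
  case False
  then obtain f where f: "f \<in> F" by blast
  have "0 \<le> \<bar>\<Sum>i=1..t. a f (z i)\<bar> / real t" by simp
  also have "\<dots> \<le> sup_average a F t z" using K f by (rule le_sup_average)
  finally have "0 \<le> sup_average a F t z" .
  moreover have "sup_average a F t z \<le> K"
    using abs_average_le[of F t a z, OF K] assms(1) False by (intro sup_average_least) auto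
  ultimately show ?thesis by simp
qed (simp add: sup_average_def)

text \<open>Each index is left out exactly once among the \<open>Suc t\<close> inner sums and is
  therefore counted \<open>t\<close> times.\<close>

lemma sum_leave_one_out:
  fixes b :: "nat \<Rightarrow> real"
  shows "(\<Sum>i=1..Suc t. \<Sum>j=1..t. b (Transposition.transpose i (Suc t) j)) = real t * (\<Sum>j=1..Suc t. b j)"
proof -
  have "(\<Sum>j=1..t. b (Transposition.transpose i (Suc t) j)) = (\<Sum>j=1..Suc t. b j) - b i"
    if "i \<in> {1..Suc t}" for i
  proof -
    have "Transposition.transpose i (Suc t) permutes {1..Suc t}"
      using that by (intro permutes_swap_id) auto
    from sum.permute[OF this, of b] show ?thesis by (simp add: comp_def)
  qed
  then have "(\<Sum>i=1..Suc t. \<Sum>j=1..t. b (Transposition.transpose i (Suc t) j))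
      = (\<Sum>i=1..Suc t. (\<Sum>j=1..Suc t. b j) - b i)"
    by (intro sum.cong) auto
  also have "\<dots> = real (Suc t) * (\<Sum>j=1..Suc t. b j) - (\<Sum>j=1..Suc t. b j)"
    by (simp only: sum_subtractf sum_constant card_atLeastAtMost) simp
  finally show ?thesis by (simp add: algebra_simps)
qed

text \<open>For a fixed \<open>f\<close> the full average is the mean of the leave-one-out averages;
  the triangle inequality and a bound of each term by its own supremum do the rest.\<close>

lemma sup_average_leave_one_out:
  assumes t: "t \<ge> 1" and K: "\<And>f i. f \<in> F \<Longrightarrow> i \<in> {1..Suc t} \<Longrightarrow> \<bar>a f (z i)\<bar> \<le> K"
  shows "sup_average a F (Suc t) z
    \<le> (\<Sum>i=1..Suc t. sup_average a F t (\<lambda>j. z (Transposition.transpose i (Suc t) j))) / real (Suc t)"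
proof (cases "F = {}")
  case True
  then show ?thesis by (simp add: sup_average_def field_simps)
next
  case False
  let ?\<tau> = "\<lambda>i. Transposition.transpose i (Suc t)"
  show ?thesis
  proof (rule sup_average_least[OF False])
    fix f assume f: "f \<in> F"
    have "\<bar>\<Sum>i=1..Suc t. a f (z i)\<bar> = \<bar>\<Sum>i=1..Suc t. (\<Sum>j=1..t. a f (z (?\<tau> i j)))\<bar> / real t"
      using t sum_leave_one_out[of "\<lambda>i. a f (z i)" t] by (simp add: abs_mult)
    also have "\<dots> \<le> (\<Sum>i=1..Suc t. \<bar>\<Sum>j=1..t. a f (z (?\<tau> i j))\<bar>) / real t"
      by (intro divide_right_mono sum_abs) auto
    also have "\<dots> = (\<Sum>i=1..Suc t. \<bar>\<Sum>j=1..t. a f (z (?\<tau> i j))\<bar> / real t)"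
      by (rule sum_divide_distrib)
    also have "\<dots> \<le> (\<Sum>i=1..Suc t. sup_average a F t (\<lambda>j. z (?\<tau> i j)))"
    proof (intro sum_mono le_sup_average[OF _ f])
      show "\<bar>a f (z (?\<tau> i j))\<bar> \<le> K" if "f \<in> F" "i \<in> {1..Suc t}" "j \<in> {1..t}" for f i j
        using that by (intro K) (auto simp: Transposition.transpose_def)
    qed
    finally show "\<bar>\<Sum>i=1..Suc t. a f (z i)\<bar> / real (Suc t)
        \<le> (\<Sum>i=1..Suc t. sup_average a F t (\<lambda>j. z (?\<tau> i j))) / real (Suc t)"
      by (intro divide_right_mono) auto
  qed
qed

lemma sup_average_upd_le:
  assumes i: "i \<in> {1..t}" and "0 \<le> c"
    and K: "\<And>f j. f \<in> F \<Longrightarrow> j \<in> {1..t} \<Longrightarrow> \<bar>a f ((z(i := y)) j)\<bar> \<le> K"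
    and c: "\<And>f. f \<in> F \<Longrightarrow> \<bar>a f (z i) - a f y\<bar> \<le> c"
  shows "sup_average a F t z \<le> sup_average a F t (z(i := y)) + c / real t"
proof (cases "F = {}")
  case True
  then show ?thesis using \<open>0 \<le> c\<close> by (simp add: sup_average_def)
next
  case False
  show ?thesis
  proof (rule sup_average_least[OF False])
    fix f assume f: "f \<in> F"
    have *: "(\<Sum>j=1..t. a f (w j)) = a f (w i) + (\<Sum>j\<in>{1..t} - {i}. a f (w j))" for w :: "nat \<Rightarrow> 'b"
      using i by (intro sum.remove) auto
    have "(\<Sum>j=1..t. a f (z j)) = (\<Sum>j=1..t. a f ((z(i := y)) j)) + (a f (z i) - a f y)"
      unfolding * by (auto intro: sum.cong)
    then have "\<bar>\<Sum>j=1..t. a f (z j)\<bar> / real t \<le> (\<bar>\<Sum>j=1..t. a f ((z(i := y)) j)\<bar> + c) / real t"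
      using c[OF f] by (intro divide_right_mono) auto
    also have "\<dots> = \<bar>\<Sum>j=1..t. a f ((z(i := y)) j)\<bar> / real t + c / real t"
      by (rule add_divide_distrib)
    also have "\<dots> \<le> sup_average a F t (z(i := y)) + c / real t"
      by (intro add_right_mono le_sup_average[of F t a "z(i := y)", OF K f])
    finally show "\<bar>\<Sum>j=1..t. a f (z j)\<bar> / real t \<le> sup_average a F t (z(i := y)) + c / real t" .
  qed
qed

lemma sup_average_bounded_difference:
  assumes i: "i \<in> {1..t}" and "0 \<le> c"
    and K: "\<And>f j. f \<in> F \<Longrightarrow> j \<in> {1..t} \<Longrightarrow> \<bar>a f (z j)\<bar> \<le> K" "\<And>f. f \<in> F \<Longrightarrow> \<bar>a f y\<bar> \<le> K"
    and c: "\<And>f. f \<in> F \<Longrightarrow> \<bar>a f (z i) - a f y\<bar> \<le> c"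
  shows "\<bar>sup_average a F t z - sup_average a F t (z(i := y))\<bar> \<le> c / real t"
proof -
  have "sup_average a F t z \<le> sup_average a F t (z(i := y)) + c / real t"
    using K c by (intro sup_average_upd_le[OF i \<open>0 \<le> c\<close>, where K=K]) auto
  \<comment> \<open>The reverse bound comes from undoing the update, since \<open>z\<close> is
    itself a one-point change of \<open>z(i := y)\<close>.\<close>
  moreover have "sup_average a F t (z(i := y)) \<le> sup_average a F t ((z(i := y))(i := z i)) + c / real t"
    using K c i by (intro sup_average_upd_le[OF i \<open>0 \<le> c\<close>, where K=K]) (auto simp: abs_minus_commute)
  ultimately show ?thesis by (simp add: abs_le_iff)
qed

section \<open>Rademacher suprema of sign-valued classes\<close>

lemma rademacher_sup_eq:
  "rademacher_sup F t e x = sup_average (\<lambda>f (s, u). s * f u) F t (\<lambda>i. (e i, x i))"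
  by (simp add: rademacher_sup_def sup_average_def)

lemma rademacher_sup_cong:
  "(\<And>i. i \<in> {1..t} \<Longrightarrow> e i = e' i) \<Longrightarrow> (\<And>i. i \<in> {1..t} \<Longrightarrow> x i = x' i) \<Longrightarrow>
    rademacher_sup F t e x = rademacher_sup F t e' x'"
  unfolding rademacher_sup_eq by (intro sup_average_cong) auto

lemma rademacher_sup_permute:
  "\<pi> permutes {1..t} \<Longrightarrow> rademacher_sup F t (\<lambda>i. e (\<pi> i)) (\<lambda>i. x (\<pi> i)) = rademacher_sup F t e x"
  unfolding rademacher_sup_eq by (rule sup_average_permute)

locale binary_class =
  fixes F :: "('x \<Rightarrow> real) set"
  assumes sign_valued: "\<And>f u. f \<in> F \<Longrightarrow> f u = -1 \<or> f u = 1"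
begin

lemma abs_eq_one: "f \<in> F \<Longrightarrow> \<bar>f u\<bar> = 1"
  using sign_valued[of f u] by auto

text \<open>The total size of the first \<open>t\<close> multipliers bounds every summand uniformly
  in \<open>f\<close>, so the supremum is over a bounded set for arbitrary reals \<open>e\<close>,
  not only for signs. Pointwise use is thus safe off the almost sure event where the signs are
  proper.\<close>

lemma le_rademacher_sup:
  assumes "f \<in> F"
  shows "\<bar>\<Sum>i=1..t. e i * f (x i)\<bar> / real t \<le> rademacher_sup F t e x"
proof -
  have "\<bar>e i * f (x i)\<bar> \<le> (\<Sum>i=1..t. \<bar>e i\<bar>)" if "f \<in> F" "i \<in> {1..t}" for f i
    using that member_le_sum[of i "{1..t}" "\<lambda>i. \<bar>e i\<bar>"] by (simp add: abs_mult abs_eq_one)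
  then show ?thesis
    unfolding rademacher_sup_eq
    using le_sup_average[of F t "\<lambda>f (s, u). s * f u" "\<lambda>i. (e i, x i)" _ f] assms by fastforce
qed

lemma rademacher_sup_least:
  "F \<noteq> {} \<Longrightarrow> (\<And>f. f \<in> F \<Longrightarrow> \<bar>\<Sum>i=1..t. e i * f (x i)\<bar> / real t \<le> c) \<Longrightarrow> rademacher_sup F t e x \<le> c"
  unfolding rademacher_sup_eq by (rule sup_average_least) auto

lemma abs_rademacher_sup_le:
  assumes "t \<ge> 1" "\<And>i. i \<in> {1..t} \<Longrightarrow> \<bar>e i\<bar> \<le> 1"
  shows "\<bar>rademacher_sup F t e x\<bar> \<le> max 1 \<bar>Sup {}\<bar>"
  unfolding rademacher_sup_eq
  using assms by (intro abs_sup_average_le) (auto simp: abs_mult abs_eq_one)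

lemma rademacher_sup_leave_one_out:
  assumes "t \<ge> 1"
  shows "rademacher_sup F (Suc t) e x \<le> (\<Sum>i=1..Suc t. rademacher_sup F t
      (\<lambda>j. e (Transposition.transpose i (Suc t) j)) (\<lambda>j. x (Transposition.transpose i (Suc t) j))) / real (Suc t)"
proof -
  have "\<bar>e i * f (x i)\<bar> \<le> (\<Sum>i=1..Suc t. \<bar>e i\<bar>)" if "f \<in> F" "i \<in> {1..Suc t}" for f i
    using that member_le_sum[of i "{1..Suc t}" "\<lambda>i. \<bar>e i\<bar>"] by (simp add: abs_mult abs_eq_one)
  then show ?thesis
    unfolding rademacher_sup_eq using assms by (intro sup_average_leave_one_out) auto
qed

text \<open>Only the point is exchanged and its sign is kept, so one summand changes by at most
  \<open>\<bar>f (x i) - f y\<bar>\<close>, that is by at most 2.\<close>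

lemma rademacher_sup_bounded_difference:
  assumes "i \<in> {1..t}" "\<And>i. i \<in> {1..t} \<Longrightarrow> \<bar>e i\<bar> \<le> 1"
  shows "\<bar>rademacher_sup F t e x - rademacher_sup F t e (x(i := y))\<bar> \<le> 2 / real t"
proof -
  have "\<bar>e i * f (x i) - e i * f y\<bar> \<le> 2" if "f \<in> F" for f
    using sign_valued[OF that, of "x i"] sign_valued[OF that, of y] assms(2)[OF assms(1)]
    by (auto simp: abs_le_iff)
  moreover have "(\<lambda>j. (e j, (x(i := y)) j)) = (\<lambda>j. (e j, x j))(i := (e i, y))" by auto
  ultimately show ?thesis
    unfolding rademacher_sup_eq using assms
    by (auto simp only: intro!: sup_average_bounded_difference[where K=1]) (auto simp: abs_mult abs_eq_one)
qed

end

text \<open>\<open>R\<close> is the law of one sign and \<open>D\<close> that of one data point.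
  Since \<open>D\<close> lives on the whole type, every frozen sequence restricts to a point of the
  product space, and joint measurability of the supremum gives measurability in the signs
  alone.\<close>

locale rademacher_process = binary_class F + R: prob_space R + D: prob_space D
  for F :: "('x \<Rightarrow> real) set" and R :: "real measure" and D :: "'x measure" +
  assumes sets_R: "sets R = sets borel"
    and signs: "AE s in R. s = -1 \<or> s = 1"
    and space_D: "space D = UNIV"
    and measurable_sup: "\<And>t. t \<ge> 1 \<Longrightarrow> (\<lambda>(e, x). rademacher_sup F t e x) \<in>
      borel_measurable (Pi\<^sub>M {1..t} (\<lambda>_. R) \<Otimes>\<^sub>M Pi\<^sub>M {1..t} (\<lambda>_. D))"
begin

text \<open>The empirical Rademacher complexity as a function of a frozen data sequence, with the
  signs integrated over their canonical law instead of over \<open>M\<close>.\<close>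

definition mean_sup :: "nat \<Rightarrow> (nat \<Rightarrow> 'x) \<Rightarrow> real" where
  "mean_sup t x = (\<integral>e. rademacher_sup F t e x \<partial>iid_space R)"

sublocale QR: prob_space "iid_space R"
  by (rule prob_space_PiM) unfold_locales

lemma AE_signs: "AE e in iid_space R. \<forall>i\<in>{1..}. e i = -1 \<or> e i = 1"
proof (subst AE_ball_countable)
  show "\<forall>i\<in>{1..}. AE e in iid_space R. e i = -1 \<or> e i = 1"
    using signs by (auto intro!: AE_PiM_component R.prob_space_axioms)
qed auto

lemma AE_abs_signs: "AE e in iid_space R. \<forall>i\<in>{1..t}. \<bar>e i\<bar> \<le> 1"
  using AE_signs by eventually_elim force

lemma restrict_rademacher_sup:
  "rademacher_sup F t (restrict e {1..t}) x = rademacher_sup F t e x"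
  "rademacher_sup F t e (restrict x {1..t}) = rademacher_sup F t e x"
  by (intro rademacher_sup_cong; simp)+

lemma measurable_signs:
  assumes t: "t \<ge> 1"
  shows "(\<lambda>e. rademacher_sup F t e x) \<in> borel_measurable (iid_space R)"
proof -
  have "restrict x {1..t} \<in> space (Pi\<^sub>M {1..t} (\<lambda>_. D))"
    by (auto simp: space_PiM space_D)
  then have "(\<lambda>e. (restrict e {1..t}, restrict x {1..t})) \<in>
      iid_space R \<rightarrow>\<^sub>M Pi\<^sub>M {1..t} (\<lambda>_. R) \<Otimes>\<^sub>M Pi\<^sub>M {1..t} (\<lambda>_. D)"
    by (intro measurable_Pair measurable_restrict_iid measurable_const) auto
  from measurable_compose[OF this measurable_sup[OF t]] show ?thesis
    by (simp add: restrict_rademacher_sup)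
qed

lemma integrable_signs: "t \<ge> 1 \<Longrightarrow> integrable (iid_space R) (\<lambda>e. rademacher_sup F t e x)"
  using AE_abs_signs[of t]
  by (intro QR.integrable_const_bound[where B="max 1 \<bar>Sup {}\<bar>"] measurable_signs)
    (auto elim!: eventually_mono intro!: abs_rademacher_sup_le)

text \<open>The signs are exchangeable, so a permutation of the data alone may be accompanied by the
  same permutation of the signs. The bound \<open>s\<close> may exceed \<open>t\<close>, since the
  leave-one-out transpositions move index \<open>Suc t\<close>.\<close>

lemma mean_sup_permuted_signs:
  assumes "t \<ge> 1" "\<pi> permutes {1..s}"
  shows "mean_sup t x = (\<integral>e. rademacher_sup F t (\<lambda>i. e (\<pi> i)) x \<partial>iid_space R)"
  unfolding mean_sup_def
  using R.integral_permute[OF assms(2) measurable_signs[OF assms(1)]] by simp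

lemma integrable_permuted_signs:
  assumes "t \<ge> 1" "\<pi> permutes {1..s}"
  shows "integrable (iid_space R) (\<lambda>e. rademacher_sup F t (\<lambda>i. e (\<pi> i)) x)"
  using integrable_signs[OF assms(1)]
  by (intro integrable_distr[OF measurable_permute[OF assms(2)]]) (simp add: R.distr_permute[OF assms(2)])

lemma mean_sup_bounded_difference:
  assumes i: "i \<in> {1..t}"
  shows "\<bar>mean_sup t x - mean_sup t (x(i := y))\<bar> \<le> 2 / real t"
proof -
  have t: "t \<ge> 1" using i by auto
  have "\<bar>mean_sup t x - mean_sup t (x(i := y))\<bar>
      = \<bar>\<integral>e. rademacher_sup F t e x - rademacher_sup F t e (x(i := y)) \<partial>iid_space R\<bar>"
    unfolding mean_sup_def using integrable_signs[OF t] by simp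
  also have "\<dots> \<le> (\<integral>e. \<bar>rademacher_sup F t e x - rademacher_sup F t e (x(i := y))\<bar> \<partial>iid_space R)"
    by (rule integral_abs_bound)
  also have "\<dots> \<le> (\<integral>e. 2 / real t \<partial>iid_space R)"
    using AE_abs_signs[of t] integrable_signs[OF t]
    by (intro integral_mono_AE) (auto elim!: eventually_mono intro!: rademacher_sup_bounded_difference[OF i])
  finally show ?thesis by (simp add: QR.prob_space)
qed

lemma measurable_data_signs:
  assumes t: "t \<ge> 1"
  shows "(\<lambda>(x, e). rademacher_sup F t e x) \<in> borel_measurable (Pi\<^sub>M {1..t} (\<lambda>_. D) \<Otimes>\<^sub>M iid_space R)"
proof -
  have "(\<lambda>(x, e). (restrict e {1..t}, x)) \<in> Pi\<^sub>M {1..t} (\<lambda>_. D) \<Otimes>\<^sub>M iid_space R \<rightarrow>\<^sub>M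
      Pi\<^sub>M {1..t} (\<lambda>_. R) \<Otimes>\<^sub>M Pi\<^sub>M {1..t} (\<lambda>_. D)"
    using measurable_restrict_iid[of 1 t R] by measurable
  from measurable_compose[OF this measurable_sup[OF t]] show ?thesis
    by (simp add: restrict_rademacher_sup case_prod_beta')
qed

text \<open>The pointwise leave-one-out inequality transposes signs and data together; integration
  over the signs absorbs their transposition and leaves an inequality in the data alone. The bound
  on \<open>mean_sup\<close> needs only almost sure signs, so it holds for every data
  sequence.\<close>

sublocale mean: leave_one_out D mean_sup "max 1 \<bar>Sup {}\<bar>"
proof unfold_locales
  fix t :: nat and x :: "nat \<Rightarrow> 'x" assume t: "t \<ge> 1"
  show "mean_sup t \<in> borel_measurable (Pi\<^sub>M {1..t} (\<lambda>_. D))"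
    unfolding mean_sup_def using measurable_data_signs[OF t]
    by (rule QR.borel_measurable_lebesgue_integral)
  have "\<bar>mean_sup t x\<bar> \<le> (\<integral>e. \<bar>rademacher_sup F t e x\<bar> \<partial>iid_space R)"
    unfolding mean_sup_def by (rule integral_abs_bound)
  also have "\<dots> \<le> (\<integral>e. max 1 \<bar>Sup {}\<bar> \<partial>iid_space R)"
    using AE_abs_signs[of t] integrable_signs[OF t] t
    by (intro integral_mono_AE) (auto elim!: eventually_mono intro!: abs_rademacher_sup_le)
  finally show "\<bar>mean_sup t x\<bar> \<le> max 1 \<bar>Sup {}\<bar>" by (simp add: QR.prob_space)
  show "mean_sup t (restrict x {1..t}) = mean_sup t x"
    by (simp add: mean_sup_def restrict_rademacher_sup)
  show "mean_sup t (\<lambda>i. x (\<pi> i)) = mean_sup t x" if "\<pi> permutes {1..t}" for \<pi>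
    unfolding mean_sup_permuted_signs[OF t that, of "\<lambda>i. x (\<pi> i)"] rademacher_sup_permute[OF that]
    by (simp add: mean_sup_def)
  let ?\<tau> = "\<lambda>i. Transposition.transpose i (Suc t)"
  have \<tau>: "?\<tau> i permutes {1..Suc t}" if "i \<in> {1..Suc t}" for i
    using that by (intro permutes_swap_id) auto
  have "mean_sup (Suc t) x \<le>
      (\<integral>e. (\<Sum>i=1..Suc t. rademacher_sup F t (\<lambda>j. e (?\<tau> i j)) (\<lambda>j. x (?\<tau> i j))) / real (Suc t) \<partial>iid_space R)"
    unfolding mean_sup_def
    by (intro integral_mono integrable_signs rademacher_sup_leave_one_out t Bochner_Integration.integrable_divide
        Bochner_Integration.integrable_sum integrable_permuted_signs[OF t \<tau>]) auto
  also have "\<dots> = (\<Sum>i=1..Suc t. mean_sup t (\<lambda>j. x (?\<tau> i j))) / real (Suc t)"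
    by (subst integral_divide_zero, subst Bochner_Integration.integral_sum)
      (auto simp del: sum.cl_ivl_Suc intro!: integrable_permuted_signs[OF t \<tau>] sum.cong
        simp: mean_sup_permuted_signs[OF t \<tau>])
  finally show "mean_sup (Suc t) x \<le> (\<Sum>i=1..Suc t. mean_sup t (\<lambda>j. x (?\<tau> i j))) / real (Suc t)" .
qed

lemma measurable_pair_sup:
  assumes t: "t \<ge> 1"
  shows "(\<lambda>p. rademacher_sup F t (snd p) (fst p)) \<in> borel_measurable (iid_space D \<Otimes>\<^sub>M iid_space R)"
proof -
  have "(\<lambda>p. (restrict (fst p) {1..t}, snd p)) \<in>
      iid_space D \<Otimes>\<^sub>M iid_space R \<rightarrow>\<^sub>M Pi\<^sub>M {1..t} (\<lambda>_. D) \<Otimes>\<^sub>M iid_space R"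
    using measurable_restrict_iid[of 1 t D] by measurable
  from measurable_compose[OF this measurable_data_signs[OF t]] show ?thesis
    by (simp add: restrict_rademacher_sup)
qed

lemma integral_rademacher_sup:
  assumes t: "t \<ge> 1"
  shows "(\<integral>p. rademacher_sup F t (snd p) (fst p) \<partial>(iid_space D \<Otimes>\<^sub>M iid_space R)) = (\<integral>x. mean_sup t x \<partial>iid_space D)"
proof -
  interpret DR: pair_prob_space "iid_space D" "iid_space R" ..
  have "AE p in iid_space D \<Otimes>\<^sub>M iid_space R. \<forall>i\<in>{1..t}. \<bar>snd p i\<bar> \<le> 1"
  proof (rule DR.AE_pair_measure)
    have [measurable]: "(\<lambda>p. snd p i) \<in> borel_measurable (iid_space D \<Otimes>\<^sub>M iid_space R)" if "i \<in> {1..t}" for i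
      using measurable_compose[OF measurable_snd measurable_component_singleton[of i "{1..}" "\<lambda>_. R"]] that
        measurable_cong_sets[OF refl sets_R] by force
    show "{p \<in> space (iid_space D \<Otimes>\<^sub>M iid_space R). \<forall>i\<in>{1..t}. \<bar>snd p i\<bar> \<le> 1} \<in> sets (iid_space D \<Otimes>\<^sub>M iid_space R)"
      by measurable
  qed (use AE_abs_signs[of t] in auto)
  then have "integrable (iid_space D \<Otimes>\<^sub>M iid_space R) (\<lambda>p. rademacher_sup F t (snd p) (fst p))"
    using t by (intro DR.P.integrable_const_bound[where B="max 1 \<bar>Sup {}\<bar>"] measurable_pair_sup)
      (auto elim!: eventually_mono intro!: abs_rademacher_sup_le)
  from DR.integral_fst'[OF this] show ?thesis by (simp add: mean_sup_def)
qed

end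

section \<open>Symmetrization of the risk deviation\<close>

text \<open>The maps may differ between coordinates, because they will be multiplications of random
  signs by frozen labels. Coordinatewise maps keep independence, and each keeps its
  marginal.\<close>

lemma (in prob_space) distr_coordinatewise:
  assumes f: "\<And>i. i \<in> {1..} \<Longrightarrow> f i \<in> M \<rightarrow>\<^sub>M M" "\<And>i. i \<in> {1..} \<Longrightarrow> distr M M (f i) = M"
  shows "distr (iid_space M) (iid_space M) (\<lambda>x. \<lambda>i\<in>{1::nat..}. f i (x i)) = iid_space M"
proof -
  interpret Q: prob_space "iid_space M" by (rule prob_space_PiM) unfold_locales
  have comp: "distr (iid_space M) M (\<lambda>x. x i) = M" if "i \<in> {1..}" for i
    using that prob_space_axioms by (intro distr_PiM_component) auto
  have "distr (iid_space M) (iid_space M) (\<lambda>x. \<lambda>i\<in>{1..}. x i) = distr (iid_space M) (iid_space M) (\<lambda>x. x)"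
    by (intro distr_cong) (auto simp: space_PiM)
  also have "\<dots> = iid_space M" by simp
  finally have "Q.indep_vars (\<lambda>_. M) (\<lambda>i x. x i) {1..}"
    by (subst Q.indep_vars_iff_distr_eq_PiM') (auto simp: comp intro!: PiM_cong)
  then have "Q.indep_vars (\<lambda>_. M) (\<lambda>i x. f i (x i)) {1..}"
    by (rule Q.indep_vars_compose2) (rule f)
  then have "distr (iid_space M) (iid_space M) (\<lambda>x. \<lambda>i\<in>{1..}. f i (x i))
      = Pi\<^sub>M {1..} (\<lambda>i. distr (iid_space M) M (\<lambda>x. f i (x i)))"
    using f(1) by (subst (asm) Q.indep_vars_iff_distr_eq_PiM') (auto intro: measurable_compose[OF measurable_component_singleton])
  also have "\<dots> = iid_space M"
  proof (intro PiM_cong refl)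
    fix i :: nat assume i: "i \<in> {1..}"
    have "distr (iid_space M) M (\<lambda>x. f i (x i)) = distr (distr (iid_space M) M (\<lambda>x. x i)) M (f i)"
      using f(1)[OF i] i by (subst distr_distr) (auto simp: comp_def)
    then show "distr (iid_space M) M (\<lambda>x. f i (x i)) = M" by (simp only: comp[OF i] f(2)[OF i])
  qed
  finally show ?thesis .
qed

locale symmetrization = rademacher_process F R D + P: prob_space P
  for F :: "('x \<Rightarrow> real) set" and R :: "real measure" and D :: "'x measure" and P :: "('x \<times> real) measure" +
  assumes symmetric_signs: "distr R R uminus = R"
    and labels: "\<And>u. u \<in> space P \<Longrightarrow> snd u = -1 \<or> snd u = 1"
    and measurable_point: "fst \<in> P \<rightarrow>\<^sub>M D"
    and measurable_label: "snd \<in> borel_measurable P"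
    and measurable_classifier: "\<And>f. f \<in> F \<Longrightarrow> f \<in> borel_measurable D"
    and measurable_deviation: "\<And>t. t \<ge> 1 \<Longrightarrow> sup_risk_deviation P F t \<in> borel_measurable (Pi\<^sub>M {1..t} (\<lambda>_. P))"
begin

lemma risk_in_unit: "0 \<le> risk P f" "risk P f \<le> 1"
  by (auto simp: risk_def)

lemma sup_risk_deviation_eq:
  assumes "t \<ge> 1"
  shows "sup_risk_deviation P F t =
    sup_average (\<lambda>f u. of_bool (f (fst u) \<noteq> snd u) - risk P f) F t"
proof
  fix z
  have "\<bar>emp_risk t z f - risk P f\<bar> = \<bar>\<Sum>i=1..t. of_bool (f (fst (z i)) \<noteq> snd (z i)) - risk P f\<bar> / real t" for f
  proof -
    have "emp_risk t z f - risk P f = (\<Sum>i=1..t. of_bool (f (fst (z i)) \<noteq> snd (z i)) - risk P f) / real t"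
      using assms by (simp add: emp_risk_def sum_subtractf diff_divide_distrib)
    then show ?thesis by simp
  qed
  then show "sup_risk_deviation P F t z =
      sup_average (\<lambda>f u. of_bool (f (fst u) \<noteq> snd u) - risk P f) F t z"
    by (simp add: sup_risk_deviation_def sup_average_def)
qed

lemma abs_centred_loss: "\<bar>of_bool b - risk P f\<bar> \<le> 1"
  using risk_in_unit[of f] by (auto simp: abs_le_iff)

sublocale deviation: leave_one_out P "sup_risk_deviation P F" "max 1 \<bar>Sup {}\<bar>"
proof unfold_locales
  fix t :: nat and z :: "nat \<Rightarrow> 'x \<times> real" and \<pi> assume t: "t \<ge> 1"
  show "sup_risk_deviation P F t \<in> borel_measurable (Pi\<^sub>M {1..t} (\<lambda>_. P))"
    by (rule measurable_deviation[OF t])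
  show "\<bar>sup_risk_deviation P F t z\<bar> \<le> max 1 \<bar>Sup {}\<bar>"
    unfolding sup_risk_deviation_eq[OF t] by (rule abs_sup_average_le[OF t]) (rule abs_centred_loss)
  show "sup_risk_deviation P F t (restrict z {1..t}) = sup_risk_deviation P F t z"
    unfolding sup_risk_deviation_eq[OF t] by (rule sup_average_cong) simp
  show "sup_risk_deviation P F t (\<lambda>i. z (\<pi> i)) = sup_risk_deviation P F t z" if "\<pi> permutes {1..t}"
    unfolding sup_risk_deviation_eq[OF t] by (rule sup_average_permute[OF that])
  show "sup_risk_deviation P F (Suc t) z \<le> (\<Sum>i=1..Suc t. sup_risk_deviation P F t
      (\<lambda>j. z (Transposition.transpose i (Suc t) j))) / real (Suc t)"
    using sup_risk_deviation_eq[OF t] sup_risk_deviation_eq[of "Suc t"] t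
      sup_average_leave_one_out[of t F "\<lambda>f u. of_bool (f (fst u) \<noteq> snd u) - risk P f" z 1]
      abs_centred_loss by simp
qed

text \<open>The risk cancels in the difference of two centred losses, which leaves two indicator
  values at distance at most 1, half of the constant for \<open>mean_sup\<close>.\<close>

lemma deviation_bounded_difference:
  assumes "i \<in> {1..t}"
  shows "\<bar>sup_risk_deviation P F t z - sup_risk_deviation P F t (z(i := y))\<bar> \<le> 1 / real t"
proof -
  have t: "t \<ge> 1" using assms by auto
  show ?thesis
    unfolding sup_risk_deviation_eq[OF t]
    by (rule sup_average_bounded_difference[OF assms, where K=1]) (rule abs_centred_loss | simp)+
qed

lemma measurable_rademacher_sup:
  assumes "m \<ge> 1"
    and e: "\<And>i. i \<in> {1..m} \<Longrightarrow> (\<lambda>w. e w i) \<in> borel_measurable N"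
    and x: "\<And>i. i \<in> {1..m} \<Longrightarrow> (\<lambda>w. x w i) \<in> N \<rightarrow>\<^sub>M D"
  shows "(\<lambda>w. rademacher_sup F m (e w) (x w)) \<in> borel_measurable N"
proof -
  have "(\<lambda>w. e w i) \<in> N \<rightarrow>\<^sub>M R" if "i \<in> {1..m}" for i
    using e[OF that] measurable_cong_sets[OF refl sets_R] by blast
  then have "(\<lambda>w. (restrict (e w) {1..m}, restrict (x w) {1..m})) \<in>
      N \<rightarrow>\<^sub>M Pi\<^sub>M {1..m} (\<lambda>_. R) \<Otimes>\<^sub>M Pi\<^sub>M {1..m} (\<lambda>_. D)"
    using x by (intro measurable_Pair measurable_restrict) auto
  from measurable_compose[OF this measurable_sup[OF \<open>m \<ge> 1\<close>]] show ?thesis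
    by (simp add: restrict_rademacher_sup)
qed

section \<open>The ghost sample\<close>

text \<open>A supremum of signed sums of margins \<open>y * f x\<close>, with the labels absorbed
  into the multipliers so that it remains an instance of \<open>rademacher_sup\<close>. Margins
  arise from the loss \<open>(1 - y * f x) / 2\<close>.\<close>

definition signed_sup :: "nat \<Rightarrow> (nat \<Rightarrow> real) \<Rightarrow> (nat \<Rightarrow> 'x \<times> real) \<Rightarrow> real" where
  "signed_sup m s z = rademacher_sup F m (\<lambda>i. s i * snd (z i)) (\<lambda>i. fst (z i))"

lemma measurable_signed_sup:
  assumes "m \<ge> 1"
    and s: "\<And>i. i \<in> {1..m} \<Longrightarrow> (\<lambda>w. s w i) \<in> borel_measurable N"
    and z: "\<And>i. i \<in> {1..m} \<Longrightarrow> (\<lambda>w. z w i) \<in> N \<rightarrow>\<^sub>M P"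
  shows "(\<lambda>w. signed_sup m (s w) (z w)) \<in> borel_measurable N"
  unfolding signed_sup_def
  using s measurable_compose[OF z measurable_label] measurable_compose[OF z measurable_point]
  by (intro measurable_rademacher_sup assms(1) borel_measurable_times) auto

lemma abs_signed_sup_le:
  assumes "m \<ge> 1" "\<And>i. i \<in> {1..m} \<Longrightarrow> \<bar>s i\<bar> \<le> 1" "\<And>i. i \<in> {1..m} \<Longrightarrow> z i \<in> space P"
  shows "\<bar>signed_sup m s z\<bar> \<le> max 1 \<bar>Sup {}\<bar>"
  unfolding signed_sup_def
proof (rule abs_rademacher_sup_le[OF assms(1)])
  fix i assume i: "i \<in> {1..m}"
  show "\<bar>s i * snd (z i)\<bar> \<le> 1"
    using labels[OF assms(3)[OF i]] assms(2)[OF i] by (auto simp: abs_mult)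
qed

lemma measurable_signed_sup_iid: "m \<ge> 1 \<Longrightarrow> signed_sup m s \<in> borel_measurable (iid_space P)"
  by (intro measurable_signed_sup measurable_component_singleton) auto

lemma integrable_signed_sup:
  assumes "m \<ge> 1" "\<And>i. i \<in> {1..m} \<Longrightarrow> \<bar>s i\<bar> \<le> 1"
  shows "integrable (iid_space P) (signed_sup m s)"
  using assms space_iid_spaceD
  by (intro deviation.Q.integrable_const_bound[where B="max 1 \<bar>Sup {}\<bar>"] measurable_signed_sup_iid AE_I2)
    (auto intro!: abs_signed_sup_le space_iid_spaceD)

text \<open>The supremum over \<open>f\<close> of the difference between the empirical risks of a sample and of its
  ghost is a \<open>rademacher_sup\<close> over \<open>2 * n\<close> points whose signs are labels, negated on the ghost. This
  makes it measurable by hypothesis, which the classical ghost sample argument needs.\<close>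

definition ghost_signs :: "nat \<Rightarrow> (nat \<Rightarrow> real) \<Rightarrow> nat \<Rightarrow> real" where
  "ghost_signs n s k = (if k \<le> n then s k else - s (k - n))"

lemma sum_ghost_signs:
  "(\<Sum>k=1..2 * n. ghost_signs n s k * b k) = (\<Sum>k=1..n. s k * b k) - (\<Sum>k=1..n. s k * b (k + n))"
proof -
  have "{1..2 * n} = {1..n} \<union> {1 + n..n + n}" by auto
  then have "(\<Sum>k=1..2 * n. ghost_signs n s k * b k)
      = (\<Sum>k=1..n. ghost_signs n s k * b k) + (\<Sum>k=1 + n..n + n. ghost_signs n s k * b k)"
    by (simp add: sum.union_disjoint)
  also have "(\<Sum>k=1 + n..n + n. ghost_signs n s k * b k) = (\<Sum>k=1..n. ghost_signs n s (k + n) * b (k + n))"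
    by (rule sum.shift_bounds_cl_nat_ivl)
  also have "\<dots> = - (\<Sum>k=1..n. s k * b (k + n))"
    by (auto simp: ghost_signs_def sum_negf[symmetric] intro!: sum.cong)
  also have "(\<Sum>k=1..n. ghost_signs n s k * b k) = (\<Sum>k=1..n. s k * b k)"
    by (auto simp: ghost_signs_def intro!: sum.cong)
  finally show ?thesis by simp
qed

text \<open>The involution that exchanges a sample point with its ghost twin, \<open>n\<close>
  places further, wherever the sign is -1. The constant sign -1 exchanges the whole sample with its
  ghost.\<close>

definition swap :: "nat \<Rightarrow> (nat \<Rightarrow> real) \<Rightarrow> nat \<Rightarrow> nat" where
  "swap n s k = (if k \<in> {1..n} \<and> s k = -1 then k + n
     else if k \<in> {n + 1..2 * n} \<and> s (k - n) = -1 then k - n else k)"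

lemma swap_swap: "swap n s (swap n s k) = k"
  by (auto simp: swap_def)

lemma swap_permutes: "swap n s permutes {1..2 * n}"
proof (rule inj_imp_permutes)
  show "inj_on (swap n s) {1..2 * n}" by (rule inj_on_inverseI[of _ "swap n s"]) (rule swap_swap)
qed (auto simp: swap_def)

text \<open>Exchanging a point with its twin reverses the sign of their difference, and the i.i.d.
  law does not notice the exchange. Hence any fixed sign pattern may be inserted into the ghost
  difference.\<close>

lemma integral_signed_sup_swap:
  assumes n: "n \<ge> 1" and s: "\<And>i. i \<in> {1..n} \<Longrightarrow> s i = -1 \<or> s i = 1"
  shows "(\<integral>z. signed_sup (2 * n) (ghost_signs n (\<lambda>_. 1)) z \<partial>iid_space P)
    = (\<integral>z. signed_sup (2 * n) (ghost_signs n s) z \<partial>iid_space P)"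
proof -
  have eq: "signed_sup (2 * n) (ghost_signs n (\<lambda>_. 1)) (\<lambda>i. z (swap n s i)) = signed_sup (2 * n) (ghost_signs n s) z"
    for z :: "nat \<Rightarrow> 'x \<times> real"
  proof -
    \<comment> \<open>The swap is moved from the points to the signs: as \<open>swap\<close> is an
      involution, the multipliers are \<open>?e\<close> evaluated along \<open>swap\<close>, so
      signs and points are permuted alike and \<open>rademacher_sup_permute\<close> removes the
      permutation.\<close>
    let ?e = "\<lambda>k. ghost_signs n (\<lambda>_. 1) (swap n s k) * snd (z k)"
    have "signed_sup (2 * n) (ghost_signs n (\<lambda>_. 1)) (\<lambda>i. z (swap n s i))
        = rademacher_sup F (2 * n) (\<lambda>i. ?e (swap n s i)) (\<lambda>i. fst (z (swap n s i)))"
      by (simp add: signed_sup_def swap_swap)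
    also have "\<dots> = rademacher_sup F (2 * n) ?e (\<lambda>i. fst (z i))"
      by (rule rademacher_sup_permute[OF swap_permutes])
    also have "\<dots> = signed_sup (2 * n) (ghost_signs n s) z"
      unfolding signed_sup_def
    proof (intro rademacher_sup_cong refl)
      fix k assume k: "k \<in> {1..2 * n}"
      have "s (k - n) = -1 \<or> s (k - n) = 1" if "k > n"
        using k that by (intro s) auto
      then show "?e k = ghost_signs n s k * snd (z k)"
        using s[of k] k by (auto simp: ghost_signs_def swap_def)
    qed
    finally show ?thesis .
  qed
  show ?thesis
    unfolding eq[symmetric]
    using n by (intro P.integral_permute[OF swap_permutes, symmetric] measurable_signed_sup_iid) auto
qed

text \<open>The triangle inequality separates sample and ghost. Each half is a supremum over
  \<open>n\<close> points with weight one half, due to the normalization by \<open>2 * n\<close>,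
  and both have the same integral. This holds for each fixed sign pattern.\<close>

lemma integral_ghost_le:
  assumes n: "n \<ge> 1" and s: "\<And>i. i \<in> {1..n} \<Longrightarrow> s i = -1 \<or> s i = 1" and "F \<noteq> {}"
  shows "(\<integral>z. signed_sup (2 * n) (ghost_signs n (\<lambda>_. 1)) z \<partial>iid_space P) \<le> (\<integral>z. signed_sup n s z \<partial>iid_space P)"
proof -
  \<comment> \<open>This permutation brings the ghost half to the first \<open>n\<close> places, so
    that the ghost term is \<open>signed_sup n s\<close> of a permuted sequence.\<close>
  let ?all = "swap n (\<lambda>_. -1)"
  have abs_s: "\<bar>s i\<bar> \<le> 1" if "i \<in> {1..n}" for i using s[OF that] by auto
  have abs_gs: "\<bar>ghost_signs n s i\<bar> \<le> 1" if "i \<in> {1..2 * n}" for i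
    using that by (auto simp: ghost_signs_def intro!: abs_s)
  have all: "?all k = k + n" if "k \<in> {1..n}" for k using that by (simp add: swap_def)
  have le: "signed_sup (2 * n) (ghost_signs n s) z \<le> (signed_sup n s z + signed_sup n s (\<lambda>i. z (?all i))) / 2"
    for z :: "nat \<Rightarrow> 'x \<times> real"
    unfolding signed_sup_def
  proof (rule rademacher_sup_least[OF \<open>F \<noteq> {}\<close>])
    fix f assume f: "f \<in> F"
    let ?b = "\<lambda>k. snd (z k) * f (fst (z k))"
    have "(\<Sum>k=1..n. s k * ?b (?all k)) = (\<Sum>k=1..n. s k * ?b (k + n))"
      by (intro sum.cong) (auto simp: all)
    then have "\<bar>\<Sum>k=1..2 * n. ghost_signs n s k * snd (z k) * f (fst (z k))\<bar>
        = \<bar>(\<Sum>k=1..n. s k * ?b k) - (\<Sum>k=1..n. s k * ?b (?all k))\<bar>"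
      by (simp only: mult.assoc sum_ghost_signs)
    also have "\<dots> \<le> \<bar>\<Sum>k=1..n. s k * ?b k\<bar> + \<bar>\<Sum>k=1..n. s k * ?b (?all k)\<bar>"
      by (rule abs_triangle_ineq4)
    finally have "\<bar>\<Sum>k=1..2 * n. ghost_signs n s k * snd (z k) * f (fst (z k))\<bar> / real (2 * n)
        \<le> (\<bar>\<Sum>k=1..n. s k * ?b k\<bar> + \<bar>\<Sum>k=1..n. s k * ?b (?all k)\<bar>) / real (2 * n)"
      by (rule divide_right_mono) simp
    also have "\<dots> = (\<bar>\<Sum>k=1..n. s k * snd (z k) * f (fst (z k))\<bar> / real n
        + \<bar>\<Sum>k=1..n. s k * snd (z (?all k)) * f (fst (z (?all k)))\<bar> / real n) / 2"
      using n by (simp add: mult.assoc field_simps)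
    also have "\<dots> \<le> (rademacher_sup F n (\<lambda>i. s i * snd (z i)) (\<lambda>i. fst (z i)) +
        rademacher_sup F n (\<lambda>i. s i * snd (z (?all i))) (\<lambda>i. fst (z (?all i)))) / 2"
      by (intro divide_right_mono add_mono le_rademacher_sup[OF f]) simp
    finally show "\<bar>\<Sum>k=1..2 * n. ghost_signs n s k * snd (z k) * f (fst (z k))\<bar> / real (2 * n)
      \<le> (rademacher_sup F n (\<lambda>i. s i * snd (z i)) (\<lambda>i. fst (z i)) +
        rademacher_sup F n (\<lambda>i. s i * snd (z (?all i))) (\<lambda>i. fst (z (?all i)))) / 2" .
  qed
  have int: "integrable (iid_space P) (signed_sup n s)"
    using n abs_s by (rule integrable_signed_sup)
  have int': "integrable (iid_space P) (\<lambda>z. signed_sup n s (\<lambda>i. z (?all i)))"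
    using int by (intro integrable_distr[OF measurable_permute[OF swap_permutes]]) (simp add: P.distr_permute[OF swap_permutes])
  have "(\<integral>z. signed_sup (2 * n) (ghost_signs n (\<lambda>_. 1)) z \<partial>iid_space P)
      = (\<integral>z. signed_sup (2 * n) (ghost_signs n s) z \<partial>iid_space P)"
    by (rule integral_signed_sup_swap[OF n s])
  also have "\<dots> \<le> (\<integral>z. (signed_sup n s z + signed_sup n s (\<lambda>i. z (?all i))) / 2 \<partial>iid_space P)"
    using n abs_gs int int' le by (intro integral_mono integrable_signed_sup) auto
  also have "\<dots> = ((\<integral>z. signed_sup n s z \<partial>iid_space P) + (\<integral>z. signed_sup n s (\<lambda>i. z (?all i)) \<partial>iid_space P)) / 2"
    using int int' by simp
  also have "\<dots> = (\<integral>z. signed_sup n s z \<partial>iid_space P)"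
    using P.integral_permute[OF swap_permutes measurable_signed_sup_iid[OF n]] by simp
  finally show ?thesis .
qed

text \<open>With the labels frozen, multiplying each symmetric sign by its label leaves the joint
  law of the signs unchanged, so the labels disappear.\<close>

lemma label_flip:
  assumes n: "n \<ge> 1" and z: "z \<in> space (iid_space P)"
  shows "(\<integral>s. signed_sup n s z \<partial>iid_space R) = mean_sup n (\<lambda>i. fst (z i))"
proof -
  let ?g = "\<lambda>e. rademacher_sup F n e (\<lambda>i. fst (z i))"
  have y: "snd (z i) = -1 \<or> snd (z i) = 1" if "i \<in> {1..}" for i
    using labels[OF space_iid_spaceD[OF z]] that by auto
  have m: "(\<lambda>u. u * c) \<in> R \<rightarrow>\<^sub>M R" for c :: real
    using measurable_cong_sets[OF sets_R sets_R] by simp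
  have mi: "(\<lambda>s. s i * c) \<in> iid_space R \<rightarrow>\<^sub>M R" if "i \<in> {1..}" for i and c :: real
    by (rule measurable_compose[OF measurable_component_singleton[OF that] m])
  have mul: "distr R R (\<lambda>u. u * snd (z i)) = R" if "i \<in> {1..}" for i
    using y[OF that] symmetric_signs by (auto simp: distr_id)
  have "(\<integral>s. signed_sup n s z \<partial>iid_space R) = (\<integral>s. ?g (\<lambda>i\<in>{1..}. s i * snd (z i)) \<partial>iid_space R)"
    unfolding signed_sup_def
    by (intro Bochner_Integration.integral_cong rademacher_sup_cong) auto
  also have "\<dots> = (\<integral>s. ?g s \<partial>distr (iid_space R) (iid_space R) (\<lambda>s. \<lambda>i\<in>{1..}. s i * snd (z i)))"
    by (intro integral_distr[symmetric] measurable_signs n measurable_restrict mi)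
  also have "\<dots> = (\<integral>s. ?g s \<partial>iid_space R)"
    by (subst R.distr_coordinatewise) (use m mul in auto)
  finally show ?thesis by (simp add: mean_sup_def)
qed

text \<open>The ghost integral is free of signs, so its bound for fixed patterns may be averaged
  over random ones. Fubini then puts the sign integral inside, where \<open>label_flip\<close>
  applies.\<close>

lemma integral_ghost_le_mean_sup:
  assumes n: "n \<ge> 1" and "F \<noteq> {}"
  shows "(\<integral>z. signed_sup (2 * n) (ghost_signs n (\<lambda>_. 1)) z \<partial>iid_space P)
    \<le> (\<integral>z. mean_sup n (\<lambda>i. fst (z i)) \<partial>iid_space P)" (is "?K \<le> _")
proof -
  interpret RP: pair_prob_space "iid_space R" "iid_space P" ..
  have meas: "(\<lambda>(s, z). signed_sup n s z) \<in> borel_measurable (iid_space R \<Otimes>\<^sub>M iid_space P)"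
  proof -
    have "(\<lambda>s. s i) \<in> borel_measurable (iid_space R)" if "i \<in> {1..n}" for i
    proof -
      have "(\<lambda>s. s i) \<in> iid_space R \<rightarrow>\<^sub>M R"
        using that by (intro measurable_component_singleton) auto
      then show ?thesis using measurable_cong_sets[OF refl sets_R] by blast
    qed
    moreover have "(\<lambda>z. z i) \<in> iid_space P \<rightarrow>\<^sub>M P" if "i \<in> {1..n}" for i
      using that by (intro measurable_component_singleton) auto
    ultimately show ?thesis
      unfolding case_prod_beta'
      by (intro measurable_signed_sup n measurable_compose[OF measurable_fst] measurable_compose[OF measurable_snd])
  qed
  have "AE p in iid_space R \<Otimes>\<^sub>M iid_space P. \<forall>i\<in>{1..n}. \<bar>fst p i\<bar> \<le> 1"
    by (rule AE_distrD[OF measurable_fst], subst deviation.Q.distr_pair_fst) (rule AE_abs_signs)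
  moreover have "AE p in iid_space R \<Otimes>\<^sub>M iid_space P. snd p \<in> space (iid_space P)"
    by (intro AE_I2) (auto simp: space_pair_measure)
  ultimately have "AE p in iid_space R \<Otimes>\<^sub>M iid_space P. norm (case p of (s, z) \<Rightarrow> signed_sup n s z) \<le> max 1 \<bar>Sup {}\<bar>"
    by eventually_elim (auto simp: case_prod_beta' intro!: abs_signed_sup_le n space_iid_spaceD)
  then have int: "integrable (iid_space R \<Otimes>\<^sub>M iid_space P) (\<lambda>(s, z). signed_sup n s z)"
    by (rule RP.P.integrable_const_bound) (rule meas)
  have "?K = (\<integral>s. ?K \<partial>iid_space R)" by (simp add: QR.prob_space)
  also have "\<dots> \<le> (\<integral>s. (\<integral>z. signed_sup n s z \<partial>iid_space P) \<partial>iid_space R)"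
  proof (rule integral_mono_AE)
    show "AE s in iid_space R. ?K \<le> (\<integral>z. signed_sup n s z \<partial>iid_space P)"
      using AE_signs by eventually_elim (use n \<open>F \<noteq> {}\<close> in \<open>auto intro!: integral_ghost_le\<close>)
  qed (use RP.integrable_fst'[OF int] in auto)
  also have "\<dots> = (\<integral>z. (\<integral>s. signed_sup n s z \<partial>iid_space R) \<partial>iid_space P)"
    by (rule RP.Fubini_integral[OF int, symmetric])
  also have "\<dots> = (\<integral>z. mean_sup n (\<lambda>i. fst (z i)) \<partial>iid_space P)"
    by (intro Bochner_Integration.integral_cong refl label_flip n)
  finally show ?thesis .
qed

lemma integral_loss:
  assumes "finite I" "i \<in> I" "f \<in> F"
  shows "(\<lambda>z. of_bool (f (fst (z i)) \<noteq> snd (z i)) :: real) \<in> borel_measurable (Pi\<^sub>M I (\<lambda>_. P))" (is ?m)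
    and "(\<integral>z. of_bool (f (fst (z i)) \<noteq> snd (z i)) \<partial>Pi\<^sub>M I (\<lambda>_. P)) = risk P f" (is ?i)
proof -
  let ?b = "\<lambda>u. of_bool (f (fst u) \<noteq> snd u) :: real"
  note [measurable] = measurable_compose[OF measurable_point measurable_classifier[OF \<open>f \<in> F\<close>]] measurable_label
  have meas: "?b \<in> borel_measurable P" by measurable
  show ?m by (rule measurable_compose[OF measurable_component_singleton[OF \<open>i \<in> I\<close>] meas])
  have "(\<integral>z. ?b (z i) \<partial>Pi\<^sub>M I (\<lambda>_. P)) = (\<integral>u. ?b u \<partial>distr (Pi\<^sub>M I (\<lambda>_. P)) P (\<lambda>z. z i))"
    using assms by (intro integral_distr[symmetric] meas) auto
  also have "distr (Pi\<^sub>M I (\<lambda>_. P)) P (\<lambda>z. z i) = P"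
    using assms P.prob_space_axioms by (intro distr_PiM_component) auto
  also have "(\<integral>u. ?b u \<partial>P) = (\<integral>u. indicator {u \<in> space P. f (fst u) \<noteq> snd u} u \<partial>P)"
    by (intro Bochner_Integration.integral_cong) (auto simp: indicator_def)
  also have "\<dots> = risk P f" unfolding risk_def by simp
  finally show ?i .
qed

text \<open>The risk is the mean empirical risk of a ghost sample. Jensen's inequality for the
  absolute value is applied for each \<open>f\<close>, and the supremum over \<open>f\<close> is
  taken only after integration, so that only the measurable \<open>?H\<close> is integrated.\<close>

lemma deviation_le_ghost:
  assumes n: "n \<ge> 1" and "F \<noteq> {}" and z: "z \<in> space (Pi\<^sub>M {1..n} (\<lambda>_. P))"
  shows "sup_risk_deviation P F n z \<le> (\<integral>z'. signed_sup (2 * n) (ghost_signs n (\<lambda>_. 1))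
      (merge {1..n} {n + 1..2 * n} (z, z')) \<partial>Pi\<^sub>M {n + 1..2 * n} (\<lambda>_. P))"
proof -
  let ?J = "{n + 1..2 * n}" and ?b = "\<lambda>f u. of_bool (f (fst u) \<noteq> snd u) :: real"
  let ?PJ = "Pi\<^sub>M ?J (\<lambda>_. P)" and ?w = "\<lambda>z'. merge {1..n} ?J (z, z')"
  let ?H = "signed_sup (2 * n) (ghost_signs n (\<lambda>_. 1))"
  interpret PJ: prob_space ?PJ by (rule prob_space_PiM) unfold_locales
  have zP: "z i \<in> space P" if "i \<in> {1..n}" for i
    using z that by (auto simp: space_PiM PiE_def Pi_def)
  have zP': "z' i \<in> space P" if "z' \<in> space ?PJ" "i \<in> ?J" for z' i
    using that by (auto simp: space_PiM PiE_def Pi_def)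
  have wP: "?w z' i \<in> space P" if "z' \<in> space ?PJ" "i \<in> {1..2 * n}" for z' i
    using that(2) zP[of i] zP'[OF that(1), of i] by (auto simp: merge_def)
  have meas_w: "(\<lambda>z'. ?w z' i) \<in> ?PJ \<rightarrow>\<^sub>M P" if "i \<in> {1..2 * n}" for i
  proof (cases "i \<le> n")
    case True
    then show ?thesis using that zP[of i] by (auto simp: merge_def)
  next
    case False
    then show ?thesis using that by (auto simp: merge_def)
  qed
  have intH: "integrable ?PJ (\<lambda>z'. ?H (?w z'))"
  proof (rule PJ.integrable_const_bound[where B="max 1 \<bar>Sup {}\<bar>"])
    show "(\<lambda>z'. ?H (?w z')) \<in> borel_measurable ?PJ"
      using n meas_w by (intro measurable_signed_sup) auto
    show "AE z' in ?PJ. norm (?H (?w z')) \<le> max 1 \<bar>Sup {}\<bar>"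
      unfolding real_norm_def using n
      by (intro AE_I2 abs_signed_sup_le wP) (auto simp: ghost_signs_def)
  qed
  have "\<bar>emp_risk n z f - risk P f\<bar> \<le> (\<integral>z'. ?H (?w z') \<partial>?PJ)" if f: "f \<in> F" for f
  proof -
    define B where "B z' = (\<Sum>k=1..n. ?b f (z' (k + n)))" for z'
    let ?d = "\<lambda>z'. (\<Sum>k=1..n. ?b f (z k)) / real n - B z' / real n"
    have int_b: "integrable ?PJ (\<lambda>z'. ?b f (z' (k + n)))" if "k \<in> {1..n}" for k
      using that by (intro PJ.integrable_const_bound[where B=1] integral_loss(1)[OF _ _ f] AE_I2) auto
    have int_B: "integrable ?PJ B"
      unfolding B_def using int_b by (rule Bochner_Integration.integrable_sum)
    then have int_d: "integrable ?PJ ?d" by simp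
    have "(\<integral>z'. B z' \<partial>?PJ) = (\<Sum>k=1..n. (\<integral>z'. ?b f (z' (k + n)) \<partial>?PJ))"
      unfolding B_def using int_b by (rule Bochner_Integration.integral_sum)
    also have "\<dots> = (\<Sum>k=1..n. risk P f)"
      by (intro sum.cong refl integral_loss(2)[OF _ _ f]) auto
    finally have "(\<integral>z'. ?d z' \<partial>?PJ) = emp_risk n z f - risk P f"
      using n int_B by (simp add: emp_risk_def PJ.prob_space)
    then have "\<bar>emp_risk n z f - risk P f\<bar> \<le> (\<integral>z'. \<bar>?d z'\<bar> \<partial>?PJ)"
      using integral_abs_bound[of ?PJ ?d] by simp
    also have "\<dots> \<le> (\<integral>z'. ?H (?w z') \<partial>?PJ)"
    proof (rule integral_mono)
      fix z' assume z': "z' \<in> space ?PJ"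
      let ?c = "\<lambda>k. snd (?w z' k) * f (fst (?w z' k))"
      have w1: "?w z' k = z k" and w2: "?w z' (k + n) = z' (k + n)" if "k \<in> {1..n}" for k
        using that by (auto simp: merge_def)
      have b: "?b f u = (1 - snd u * f (fst u)) / 2" if "u \<in> space P" for u
        using labels[OF that] sign_valued[OF f, of "fst u"] by auto
      have "(\<Sum>k=1..n. ?b f (z k)) - B z'
          = (\<Sum>k=1..n. (1 - ?c k) / 2) - (\<Sum>k=1..n. (1 - ?c (k + n)) / 2)"
        unfolding B_def using zP zP'[OF z'] by (intro arg_cong2[where f=minus] sum.cong) (auto simp: b w1 w2)
      also have "\<dots> = - ((\<Sum>k=1..n. ?c k) - (\<Sum>k=1..n. ?c (k + n))) / 2"
        by (simp add: sum_subtractf diff_divide_distrib sum_divide_distrib)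
      also have "(\<Sum>k=1..n. ?c k) - (\<Sum>k=1..n. ?c (k + n)) = (\<Sum>k=1..2 * n. ghost_signs n (\<lambda>_. 1) k * ?c k)"
        by (simp only: sum_ghost_signs mult_1)
      \<comment> \<open>The half in the loss turns the average over \<open>n\<close> points into the
        normalization by \<open>2 * n\<close>.\<close>
      finally have "\<bar>?d z'\<bar> = \<bar>\<Sum>k=1..2 * n. (ghost_signs n (\<lambda>_. 1) k * snd (?w z' k)) * f (fst (?w z' k))\<bar> / real (2 * n)"
        by (simp add: diff_divide_distrib[symmetric] mult.assoc abs_divide)
      also have "\<dots> \<le> ?H (?w z')"
        unfolding signed_sup_def by (rule le_rademacher_sup[OF f])
      finally show "\<bar>?d z'\<bar> \<le> ?H (?w z')" .
    qed (use int_d intH in auto)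
    finally show ?thesis .
  qed
  then show ?thesis
    unfolding sup_risk_deviation_def using \<open>F \<noteq> {}\<close> by (intro cSUP_least) auto
qed

lemma expected_deviation_le:
  assumes n: "n \<ge> 1"
  shows "(\<integral>z. sup_risk_deviation P F n z \<partial>iid_space P) \<le> (\<integral>z. mean_sup n (\<lambda>i. fst (z i)) \<partial>iid_space P)"
proof (cases "F = {}")
  case True
  \<comment> \<open>For the empty class both integrands are the same unspecified constant.\<close>
  have "sup_risk_deviation P F n z = Sup {}" for z
    using True by (simp add: sup_risk_deviation_def)
  moreover have "mean_sup n x = Sup {}" for x
    unfolding mean_sup_def using True by (simp add: rademacher_sup_def QR.prob_space)
  ultimately show ?thesis by simp
next
  case False
  let ?I = "{1..n}" and ?J = "{n + 1..2 * n}"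
  let ?H = "signed_sup (2 * n) (ghost_signs n (\<lambda>_. 1))"
  interpret PP: product_sigma_finite "\<lambda>_. P" ..
  interpret PI: prob_space "Pi\<^sub>M ?I (\<lambda>_. P)" by (rule prob_space_PiM) unfold_locales
  interpret PJ: prob_space "Pi\<^sub>M ?J (\<lambda>_. P)" by (rule prob_space_PiM) unfold_locales
  interpret P2: prob_space "Pi\<^sub>M {1..2 * n} (\<lambda>_. P)" by (rule prob_space_PiM) unfold_locales
  have un: "?I \<union> ?J = {1..2 * n}" by auto
  have measH: "?H \<in> borel_measurable (Pi\<^sub>M {1..2 * n} (\<lambda>_. P))"
    using n by (intro measurable_signed_sup measurable_component_singleton) auto
  have boundH: "\<bar>?H z\<bar> \<le> max 1 \<bar>Sup {}\<bar>" if "z \<in> space (Pi\<^sub>M {1..2 * n} (\<lambda>_. P))" for z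
    using n that by (intro abs_signed_sup_le) (auto simp: ghost_signs_def space_PiM)
  have intH: "integrable (Pi\<^sub>M (?I \<union> ?J) (\<lambda>_. P)) ?H"
    unfolding un using measH boundH
    by (intro P2.integrable_const_bound[where B="max 1 \<bar>Sup {}\<bar>"] AE_I2) auto
  have merge: "merge ?I ?J (z, z') \<in> space (Pi\<^sub>M {1..2 * n} (\<lambda>_. P))"
    if "z \<in> space (Pi\<^sub>M ?I (\<lambda>_. P))" "z' \<in> space (Pi\<^sub>M ?J (\<lambda>_. P))" for z z'
    using measurable_space[OF measurable_merge[of ?I ?J "\<lambda>_. P"], of "(z, z')"] that un
    by (auto simp: space_pair_measure)
  have measHm: "(\<lambda>(z, z'). ?H (merge ?I ?J (z, z'))) \<in> borel_measurable (Pi\<^sub>M ?I (\<lambda>_. P) \<Otimes>\<^sub>M Pi\<^sub>M ?J (\<lambda>_. P))"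
    using measurable_compose[OF measurable_merge[of ?I ?J "\<lambda>_. P"], of ?H borel] measH un by simp
  have int: "integrable (Pi\<^sub>M ?I (\<lambda>_. P)) (\<lambda>z. \<integral>z'. ?H (merge ?I ?J (z, z')) \<partial>Pi\<^sub>M ?J (\<lambda>_. P))"
  proof (rule PI.integrable_const_bound[where B="max 1 \<bar>Sup {}\<bar>"])
    show "(\<lambda>z. \<integral>z'. ?H (merge ?I ?J (z, z')) \<partial>Pi\<^sub>M ?J (\<lambda>_. P)) \<in> borel_measurable (Pi\<^sub>M ?I (\<lambda>_. P))"
      using measHm by (rule PJ.borel_measurable_lebesgue_integral)
    show "AE z in Pi\<^sub>M ?I (\<lambda>_. P). norm (\<integral>z'. ?H (merge ?I ?J (z, z')) \<partial>Pi\<^sub>M ?J (\<lambda>_. P)) \<le> max 1 \<bar>Sup {}\<bar>"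
    proof (rule AE_I2)
      fix z assume z: "z \<in> space (Pi\<^sub>M ?I (\<lambda>_. P))"
      have "norm (\<integral>z'. ?H (merge ?I ?J (z, z')) \<partial>Pi\<^sub>M ?J (\<lambda>_. P))
          \<le> (\<integral>z'. norm (?H (merge ?I ?J (z, z'))) \<partial>Pi\<^sub>M ?J (\<lambda>_. P))"
        by (rule integral_norm_bound)
      also have "\<dots> \<le> (\<integral>z'. max 1 \<bar>Sup {}\<bar> \<partial>Pi\<^sub>M ?J (\<lambda>_. P))"
        using boundH[OF merge[OF z]] by (intro integral_mono') auto
      finally show "norm (\<integral>z'. ?H (merge ?I ?J (z, z')) \<partial>Pi\<^sub>M ?J (\<lambda>_. P)) \<le> max 1 \<bar>Sup {}\<bar>"
        by (simp add: PJ.prob_space)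
    qed
  qed
  have "(\<integral>z. sup_risk_deviation P F n z \<partial>iid_space P) = (\<integral>z. sup_risk_deviation P F n z \<partial>Pi\<^sub>M ?I (\<lambda>_. P))"
    using deviation.integral_prefix[OF n] by simp
  also have "\<dots> \<le> (\<integral>z. (\<integral>z'. ?H (merge ?I ?J (z, z')) \<partial>Pi\<^sub>M ?J (\<lambda>_. P)) \<partial>Pi\<^sub>M ?I (\<lambda>_. P))"
  proof (rule integral_mono)
    show "integrable (Pi\<^sub>M ?I (\<lambda>_. P)) (sup_risk_deviation P F n)"
      using measurable_deviation[OF n] deviation.bounded[OF n]
      by (intro PI.integrable_const_bound[where B="max 1 \<bar>Sup {}\<bar>"] AE_I2) auto
  qed (use int deviation_le_ghost[OF n False] in auto)
  \<comment> \<open>By Fubini, a sample and its ghost merge into one sample of \<open>2 * n\<close>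
    points, which is then read as a prefix of the infinite sequence.\<close>
  also have "\<dots> = (\<integral>z. ?H z \<partial>Pi\<^sub>M {1..2 * n} (\<lambda>_. P))"
    unfolding un[symmetric] by (rule PP.product_integral_fold[symmetric, OF _ _ _ intH]) auto
  also have "\<dots> = (\<integral>z. ?H (restrict z {1..2 * n}) \<partial>iid_space P)"
    by (rule P.integral_restrict_iid[symmetric, OF measH])
  also have "\<dots> = (\<integral>z. ?H z \<partial>iid_space P)"
    unfolding signed_sup_def by (intro Bochner_Integration.integral_cong rademacher_sup_cong) auto
  also have "\<dots> \<le> (\<integral>z. mean_sup n (\<lambda>i. fst (z i)) \<partial>iid_space P)"
    by (rule integral_ghost_le_mean_sup[OF n False])
  finally show ?thesis .
qed

end

section \<open>The exchangeable filtration\<close>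

lemma space_exchangeable_algebra [simp]: "space (exchangeable_algebra M X t) = space M"
  by (simp add: exchangeable_algebra_def space_measure_of_conv)

lemma sets_exchangeable_algebra:
  "sets (exchangeable_algebra M X t) = sigma_sets (space M)
     {(\<lambda>\<omega>. g (\<lambda>i\<in>{1..}. X i \<omega>)) -` B \<inter> space M | g B. g \<in> symmetric_functions t \<and> B \<in> sets borel}"
  unfolding exchangeable_algebra_def by (rule sets_measure_of) auto

lemma exchangeable_algebra_mono:
  "sets (exchangeable_algebra M X (Suc t)) \<subseteq> sets (exchangeable_algebra M X t)"
proof -
  have "symmetric_functions (Suc t) \<subseteq> symmetric_functions t"
    unfolding symmetric_functions_def using permutes_mono[of _ t "Suc t"] by auto
  then show ?thesis
    unfolding sets_exchangeable_algebra by (intro sigma_sets_subseteq) blast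
qed

text \<open>Preimages of symmetric events form a \<open>\<sigma>\<close>-algebra that contains the
  generators. This reduces tests on the exchangeable algebra to integrals over the canonical
  sequence space.\<close>

lemma exchangeable_event:
  assumes D: "sets D = sets borel"
    and X: "(\<lambda>\<omega>. \<lambda>i\<in>{1..}. X i \<omega>) \<in> M \<rightarrow>\<^sub>M iid_space D"
    and A: "A \<in> sets (exchangeable_algebra M X t)"
  shows "\<exists>B. symmetric_event D t B \<and> A = (\<lambda>\<omega>. \<lambda>i\<in>{1..}. X i \<omega>) -` B \<inter> space M"
  using A unfolding sets_exchangeable_algebra
proof (induction A rule: sigma_sets.induct)
  let ?X = "\<lambda>\<omega>. \<lambda>i\<in>{1..}. X i \<omega>"
  have Xsp: "?X \<omega> \<in> space (iid_space D)" if "\<omega> \<in> space M" for \<omega>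
    using measurable_space[OF X that] .
  have sets_eq: "sets (Pi\<^sub>M {1..} (\<lambda>_. borel)) = sets (iid_space D)"
    using D by (intro sets_PiM_cong) auto
  {
    case (Basic a)
    then obtain g B where a: "a = (\<lambda>\<omega>. g (?X \<omega>)) -` B \<inter> space M"
      and g: "g \<in> symmetric_functions t" and B: "B \<in> sets borel" by blast
    have gm: "g \<in> borel_measurable (iid_space D)"
      using g measurable_cong_sets[OF sets_eq refl] by (auto simp: symmetric_functions_def)
    have "symmetric_event D t (g -` B \<inter> space (iid_space D))"
      unfolding symmetric_event_def
    proof (intro conjI allI impI ballI)
      show "g -` B \<inter> space (iid_space D) \<in> sets (iid_space D)" using gm B by measurable
      fix \<pi> x assume \<pi>: "\<pi> permutes {1..t}" and x: "x \<in> space (iid_space D)"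
      then have "g (\<lambda>i. x (\<pi> i)) = g x"
        using g sets_eq_imp_space_eq[OF sets_eq] by (auto simp: symmetric_functions_def)
      then show "((\<lambda>i. x (\<pi> i)) \<in> g -` B \<inter> space (iid_space D)) = (x \<in> g -` B \<inter> space (iid_space D))"
        using x permute_in_iid_space(1)[OF \<pi> x] by simp
    qed
    moreover have "a = ?X -` (g -` B \<inter> space (iid_space D)) \<inter> space M"
      unfolding a using Xsp by auto
    ultimately show ?case by blast
  next
    case Empty
    show ?case by (intro exI[of _ "{}"]) (auto simp: symmetric_event_def)
  next
    case (Compl a)
    then obtain B where B: "symmetric_event D t B" "a = ?X -` B \<inter> space M" by blast
    have "symmetric_event D t (space (iid_space D) - B)"
      using B(1) permute_in_iid_space(1) by (auto simp: symmetric_event_def)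
    moreover have "space M - a = ?X -` (space (iid_space D) - B) \<inter> space M"
      unfolding B(2) using Xsp by blast
    ultimately show ?case by blast
  next
    case (Union a)
    define B where "B i = (SOME C. symmetric_event D t C \<and> a i = ?X -` C \<inter> space M)" for i
    have B: "symmetric_event D t (B i)" "a i = ?X -` B i \<inter> space M" for i
      unfolding B_def using someI_ex[OF Union.IH[of i]] by (rule conjunct1, rule conjunct2)
    have "symmetric_event D t (\<Union>i. B i)"
      using B(1) by (auto simp: symmetric_event_def)
    moreover have "(\<Union>i. a i) = ?X -` (\<Union>i. B i) \<inter> space M"
      unfolding B(2) by blast
    ultimately show ?case by blast
  }
qed

lemma (in leave_one_out) transfer_confidence:
  assumes X: "(\<lambda>\<omega>. \<lambda>i\<in>{1..}. X i \<omega>) \<in> M \<rightarrow>\<^sub>M iid_space D"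
    and law: "distr M (iid_space D) (\<lambda>\<omega>. \<lambda>i\<in>{1..}. X i \<omega>) = iid_space D"
  shows "measure M {\<omega> \<in> space M. \<forall>t\<ge>1. S t (\<lambda>i. X i \<omega>) \<le> b t} = Q.prob {x \<in> space (iid_space D). \<forall>t\<ge>1. S t x \<le> b t}"
proof -
  have eq: "S t (\<lambda>i\<in>{1..}. X i \<omega>) = S t (\<lambda>i. X i \<omega>)" if "t \<ge> 1" for t \<omega>
    using that by (intro prefix_cong) auto
  have "Q.prob {x \<in> space (iid_space D). \<forall>t\<ge>1. S t x \<le> b t}
      = measure (distr M (iid_space D) (\<lambda>\<omega>. \<lambda>i\<in>{1..}. X i \<omega>)) {x \<in> space (iid_space D). \<forall>t\<ge>1. S t x \<le> b t}"
    by (simp only: law)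
  also have "\<dots> = measure M ((\<lambda>\<omega>. \<lambda>i\<in>{1..}. X i \<omega>) -` {x \<in> space (iid_space D). \<forall>t\<ge>1. S t x \<le> b t} \<inter> space M)"
    by (rule measure_distr[OF X confidence_event])
  also have "(\<lambda>\<omega>. \<lambda>i\<in>{1..}. X i \<omega>) -` {x \<in> space (iid_space D). \<forall>t\<ge>1. S t x \<le> b t} \<inter> space M
      = {\<omega> \<in> space M. \<forall>t\<ge>1. S t (\<lambda>i. X i \<omega>) \<le> b t}"
    using measurable_space[OF X] by (auto simp: eq)
  finally show ?thesis ..
qed

text \<open>The conditional expectation minus the next term is measurable for the smaller algebra,
  and its integral over each event there is nonnegative by \<open>integral_Suc_le\<close>; such a
  function is nonnegative almost everywhere.\<close>

lemma reverse_submartingale_exchangeable: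
  fixes X :: "nat \<Rightarrow> 'm \<Rightarrow> 'b::topological_space"
  assumes "leave_one_out D S B" and "prob_space M" and D: "sets D = sets borel"
    and X: "(\<lambda>\<omega>. \<lambda>i\<in>{1..}. X i \<omega>) \<in> M \<rightarrow>\<^sub>M iid_space D"
    and law: "distr M (iid_space D) (\<lambda>\<omega>. \<lambda>i\<in>{1..}. X i \<omega>) = iid_space D"
  shows "reverse_submartingale M (exchangeable_algebra M X) (\<lambda>t \<omega>. S t (\<lambda>i. X i \<omega>))"
  unfolding reverse_submartingale_def
proof (intro allI impI conjI)
  fix t :: nat assume t: "1 \<le> t"
  let ?X = "\<lambda>\<omega>. \<lambda>i\<in>{1..}. X i \<omega>" and ?E = "exchangeable_algebra M X"
  let ?S = "\<lambda>t \<omega>. S t (\<lambda>i. X i \<omega>)"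
  interpret leave_one_out D S B by fact
  interpret M: prob_space M by fact
  have eq: "?S t = (\<lambda>\<omega>. S t (?X \<omega>))" if "t \<ge> 1" for t
    using that by (intro ext prefix_cong) auto
  have sub: "subalgebra M (?E t)" for t
    unfolding subalgebra_def
  proof (intro conjI subsetI)
    fix A assume "A \<in> sets (?E t)"
    from exchangeable_event[OF D X this] show "A \<in> sets M"
      using measurable_sets[OF X] by (auto simp: symmetric_event_def)
  qed simp
  have int: "integrable M (?S t)" if "t \<ge> 1" for t
    unfolding eq[OF that] using measurable_compose[OF X measurable_iid[OF that]] bounded[OF that]
    by (intro M.integrable_const_bound[where B=B] AE_I2) auto
  have meas: "?S t \<in> borel_measurable (?E t)" if t: "t \<ge> 1" for t
  proof (rule measurableI)
    have "sets (Pi\<^sub>M {1..} (\<lambda>_. borel)) = sets (iid_space D)"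
      using D by (intro sets_PiM_cong) auto
    then have "S t \<in> symmetric_functions t"
      using measurable_iid[OF t] symmetric[OF t] measurable_cong_sets[OF _ refl, of "Pi\<^sub>M {1..} (\<lambda>_. borel)" "iid_space D" borel]
      by (auto simp: symmetric_functions_def)
    then show "?S t -` B \<inter> space (?E t) \<in> sets (?E t)" if "B \<in> sets borel" for B
      unfolding eq[OF t] sets_exchangeable_algebra space_exchangeable_algebra
      using that by (intro sigma_sets.Basic) blast
  qed simp
  have int_event: "(\<integral>\<omega>\<in>?X -` B \<inter> space M. ?S s \<omega> \<partial>M) = (\<integral>x. S s x * indicator B x \<partial>iid_space D)"
    if s: "s \<ge> 1" and B: "B \<in> sets (iid_space D)" for s B
  proof -
    have "(\<integral>\<omega>\<in>?X -` B \<inter> space M. ?S s \<omega> \<partial>M) = (\<integral>\<omega>. (\<lambda>x. S s x * indicator B x) (?X \<omega>) \<partial>M)"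
      unfolding eq[OF s] set_lebesgue_integral_def
      by (intro Bochner_Integration.integral_cong) (auto simp: indicator_def)
    also have "\<dots> = (\<integral>x. S s x * indicator B x \<partial>distr M (iid_space D) ?X)"
      using B measurable_iid[OF s]
      by (intro integral_distr[symmetric] X borel_measurable_times borel_measurable_indicator)
    finally show ?thesis unfolding law .
  qed
  show "subalgebra M (?E t)" by (rule sub)
  show "subalgebra (?E t) (?E (t + 1))"
    unfolding Suc_eq_plus1[symmetric] using exchangeable_algebra_mono[of M X t] by (simp add: subalgebra_def)
  show "integrable M (?S t)" by (rule int[OF t])
  show "?S t \<in> borel_measurable (?E t)" by (rule meas[OF t])
  interpret E: finite_measure_subalgebra M "?E (t + 1)"
    by unfold_locales (rule sub)
  let ?h = "real_cond_exp M (?E (t + 1)) (?S t)"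
  let ?f = "\<lambda>\<omega>. ?h \<omega> - ?S (t + 1) \<omega>"
  have int_h: "integrable M ?h" by (rule E.real_cond_exp_int(1)[OF int[OF t]])
  have meas_f: "?f \<in> borel_measurable (?E (t + 1))"
    using meas[of "t + 1"] by (intro borel_measurable_diff) auto
  \<comment> \<open>The criterion is applied to the restricted measure, whose measurable sets are
    exactly the events on which the integrals are controlled.\<close>
  have "AE \<omega> in restr_to_subalg M (?E (t + 1)). 0 \<le> ?f \<omega>"
  proof (rule sigma_finite_measure.density_nonneg[OF E.sigma_fin_subalg])
    show "integrable (restr_to_subalg M (?E (t + 1))) ?f"
      using int_h int[of "t + 1"] by (intro integrable_in_subalg[OF sub] meas_f) auto
    fix A assume "A \<in> sets (restr_to_subalg M (?E (t + 1)))"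
    then have A: "A \<in> sets (?E (t + 1))" by (simp add: sets_restr_to_subalg[OF sub])
    obtain B where B: "symmetric_event D (Suc t) B" "A = ?X -` B \<inter> space M"
      using exchangeable_event[OF D X A] unfolding Suc_eq_plus1 by blast
    have AM: "A \<in> sets M" using A sub[of "t + 1"] by (auto simp: subalgebra_def)
    have "(\<integral>\<omega>\<in>A. ?f \<omega> \<partial>restr_to_subalg M (?E (t + 1))) = (\<integral>\<omega>\<in>A. ?f \<omega> \<partial>M)"
      unfolding set_lebesgue_integral_def using meas_f A
      by (intro integral_subalgebra2[OF sub]) auto
    also have "\<dots> = (\<integral>\<omega>\<in>A. ?h \<omega> \<partial>M) - (\<integral>\<omega>\<in>A. ?S (t + 1) \<omega> \<partial>M)"
      using int_h int[of "t + 1"] AM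
      by (intro set_integral_diff; unfold set_integrable_def; intro integrable_mult_indicator) auto
    also have "(\<integral>\<omega>\<in>A. ?h \<omega> \<partial>M) = (\<integral>\<omega>\<in>A. ?S t \<omega> \<partial>M)"
      by (rule E.real_cond_exp_intA[OF int[OF t] A, symmetric])
    also have "(\<integral>\<omega>\<in>A. ?S t \<omega> \<partial>M) - (\<integral>\<omega>\<in>A. ?S (t + 1) \<omega> \<partial>M) \<ge> 0"
      using integral_Suc_le[OF t B(1)] int_event[OF t symmetric_eventD(1)[OF B(1)]]
        int_event[OF _ symmetric_eventD(1)[OF B(1)], of "Suc t"]
      unfolding B(2) Suc_eq_plus1[symmetric] by simp
    finally show "0 \<le> (\<integral>\<omega>\<in>A. ?f \<omega> \<partial>restr_to_subalg M (?E (t + 1)))" .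
  qed
  from AE_restr_to_subalg[OF sub this] show "AE \<omega> in M. ?S (t + 1) \<omega> \<le> ?h \<omega>"
    by eventually_elim simp
qed

section \<open>Laws of i.i.d. and Rademacher sequences\<close>

lemma (in prob_space) iid_sequence_law:
  assumes "iid_sequence M D Z"
  shows "(\<lambda>\<omega>. \<lambda>i\<in>{1..}. Z i \<omega>) \<in> M \<rightarrow>\<^sub>M iid_space D"
    and "distr M (iid_space D) (\<lambda>\<omega>. \<lambda>i\<in>{1..}. Z i \<omega>) = iid_space D"
proof -
  have rv: "\<And>i. i \<in> {1..} \<Longrightarrow> Z i \<in> M \<rightarrow>\<^sub>M D"
    using assms by (auto simp: iid_sequence_def indep_vars_def)
  show "(\<lambda>\<omega>. \<lambda>i\<in>{1..}. Z i \<omega>) \<in> M \<rightarrow>\<^sub>M iid_space D"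
    by (intro measurable_restrict rv)
  have "distr M (iid_space D) (\<lambda>\<omega>. \<lambda>i\<in>{1..}. Z i \<omega>) = Pi\<^sub>M {1..} (\<lambda>i. distr M D (Z i))"
    using assms rv by (subst indep_vars_iff_distr_eq_PiM'[symmetric]) (auto simp: iid_sequence_def)
  also have "\<dots> = iid_space D"
    using assms by (intro PiM_cong) (auto simp: iid_sequence_def)
  finally show "distr M (iid_space D) (\<lambda>\<omega>. \<lambda>i\<in>{1..}. Z i \<omega>) = iid_space D" .
qed

lemma (in prob_space) iid_sequence_map:
  assumes "iid_sequence M D Z" and f: "f \<in> D \<rightarrow>\<^sub>M E" and E: "distr D E f = E"
  shows "iid_sequence M E (\<lambda>i \<omega>. f (Z i \<omega>))"
  unfolding iid_sequence_def
proof (intro conjI allI impI)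
  show "indep_vars (\<lambda>_. E) (\<lambda>i \<omega>. f (Z i \<omega>)) {1..}"
    using assms(1) f indep_vars_compose2[of "\<lambda>_. D" Z "{1..}" "\<lambda>_. f" "\<lambda>_. E"]
    by (simp add: iid_sequence_def)
  fix i :: nat assume i: "1 \<le> i"
  then have "Z i \<in> M \<rightarrow>\<^sub>M D" "distr M D (Z i) = D"
    using assms(1) by (auto simp: iid_sequence_def indep_vars_def)
  then show "distr M E (\<lambda>\<omega>. f (Z i \<omega>)) = E"
    using distr_distr[OF f, of "Z i" M] E by (simp add: comp_def)
qed

lemma (in prob_space) rademacher_AE:
  assumes "rademacher M e"
  shows "AE \<omega> in M. e \<omega> = -1 \<or> e \<omega> = 1"
proof -
  have [measurable]: "e \<in> borel_measurable M" using assms by (simp add: rademacher_def)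
  have "prob ({\<omega> \<in> space M. e \<omega> = 1} \<union> {\<omega> \<in> space M. e \<omega> = -1}) = 1"
    using assms by (subst finite_measure_Union) (auto simp: rademacher_def)
  also have "{\<omega> \<in> space M. e \<omega> = 1} \<union> {\<omega> \<in> space M. e \<omega> = -1} = {\<omega> \<in> space M. e \<omega> = -1 \<or> e \<omega> = 1}"
    by auto
  finally show ?thesis by (subst (asm) prob_Collect_eq_1) auto
qed

lemma (in prob_space) rademacher_law:
  assumes e: "rademacher M e" and A: "A \<in> sets borel"
  shows "measure (distr M borel e) A = (indicator A 1 + indicator A (-1)) / 2"
proof -
  have [measurable]: "e \<in> borel_measurable M" using e by (simp add: rademacher_def)
  let ?p = "{\<omega> \<in> space M. e \<omega> = 1 \<and> 1 \<in> A}" and ?m = "{\<omega> \<in> space M. e \<omega> = -1 \<and> -1 \<in> A}"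
  have "measure (distr M borel e) A = prob (e -` A \<inter> space M)"
    using A by (subst measure_distr) auto
  also have "\<dots> = prob (?p \<union> ?m)"
    using A rademacher_AE[OF e] by (intro finite_measure_eq_AE) (auto elim!: eventually_mono)
  also have "\<dots> = prob ?p + prob ?m" by (intro finite_measure_Union) auto
  finally show ?thesis using e by (auto simp: rademacher_def indicator_def)
qed

text \<open>Two atoms of mass one half determine the law. The same formula shows that all signs
  share the law of the first and that this law is invariant under negation.\<close>

lemma (in prob_space) rademacher_iid_sequence:
  fixes \<epsilon> :: "nat \<Rightarrow> 'a \<Rightarrow> real"
  assumes indep: "indep_vars (\<lambda>_. borel) \<epsilon> {1..}" and rad: "\<And>i. i \<ge> 1 \<Longrightarrow> rademacher M (\<epsilon> i)"
  defines "R \<equiv> distr M borel (\<epsilon> 1)"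
  shows "iid_sequence M R \<epsilon>" and "distr R R uminus = R"
proof -
  have meas: "\<epsilon> i \<in> borel_measurable M" if "i \<ge> 1" for i
    using rad[OF that] by (simp add: rademacher_def)
  have law: "measure R A = (indicator A 1 + indicator A (-1)) / 2" if "A \<in> sets borel" for A
    unfolding R_def using rademacher_law[OF rad that, of 1] by simp
  have sets_R [simp, measurable_cong]: "sets R = sets borel" by (simp add: R_def)
  interpret R: prob_space R unfolding R_def using meas[of 1] by (intro prob_space_distr) simp
  have "distr M borel (\<epsilon> i) = R" if i: "i \<ge> 1" for i
  proof (rule measure_eqI)
    interpret Ri: prob_space "distr M borel (\<epsilon> i)" using meas[OF i] by (intro prob_space_distr)
    fix A assume "A \<in> sets (distr M borel (\<epsilon> i))"
    then show "emeasure (distr M borel (\<epsilon> i)) A = emeasure R A"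
      using law[of A] rademacher_law[OF rad[OF i], of A] by (simp add: Ri.emeasure_eq_measure R.emeasure_eq_measure)
  qed simp
  moreover have "distr M R (\<epsilon> i) = distr M borel (\<epsilon> i)" for i by (intro distr_cong) auto
  moreover have "indep_vars (\<lambda>_. R) \<epsilon> {1..}"
    using indep_vars_compose2[OF indep, of "\<lambda>_ x. x" "\<lambda>_. R"] by simp
  ultimately show "iid_sequence M R \<epsilon>" by (simp add: iid_sequence_def)
  show "distr R R uminus = R"
  proof (rule measure_eqI)
    interpret N: prob_space "distr R R uminus" by (intro R.prob_space_distr) simp
    fix A assume "A \<in> sets (distr R R uminus)"
    then have A: "A \<in> sets borel" by simp
    have "uminus \<in> borel_measurable (borel :: real measure)" by simp
    from measurable_sets[OF this A] have "uminus -` A \<in> sets (borel :: real measure)" by simp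
    then have "measure (distr R R uminus) A = measure R A"
      using A law[of A] law[of "uminus -` A"]
      by (subst measure_distr) (auto simp: indicator_def sets_eq_imp_space_eq[OF sets_R])
    then show "emeasure (distr R R uminus) A = emeasure R A"
      by (simp add: N.emeasure_eq_measure R.emeasure_eq_measure)
  qed simp
qed

theorem corollary10:
  fixes M :: "'a measure"
    and P :: "('x::topological_space \<times> real) measure"
    and X :: "nat \<Rightarrow> 'a \<Rightarrow> 'x" and Y \<epsilon> :: "nat \<Rightarrow> 'a \<Rightarrow> real"
    and F :: "('x \<Rightarrow> real) set"
    and l :: "real \<Rightarrow> real" and \<delta> :: real
  assumes "prob_space M"
    and "prob_space P" and "sets P = sets labelled_borel"
    and "iid_sequence M P (\<lambda>i \<omega>. (X i \<omega>, Y i \<omega>))"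
    and "\<And>f. f \<in> F \<Longrightarrow> f \<in> borel_measurable borel \<and> range f \<subseteq> {-1, 1}"
    and "prob_space.indep_vars M (\<lambda>_. borel) \<epsilon> {1..}"
    and "\<And>i. i \<ge> 1 \<Longrightarrow> rademacher M (\<epsilon> i)"
    and "prob_space.indep_set M
           (sets (sequence_algebra M P (\<lambda>i \<omega>. (X i \<omega>, Y i \<omega>))))
           (sets (sequence_algebra M borel \<epsilon>))"
    and "\<And>t. t \<ge> 1 \<Longrightarrow>
           sup_risk_deviation P F t \<in> borel_measurable (Pi\<^sub>M {1..t} (\<lambda>_. P))"
    and "\<And>t. t \<ge> 1 \<Longrightarrow>
           (\<lambda>(e, x). rademacher_sup F t e x) \<in>
             borel_measurable (Pi\<^sub>M {1..t} (\<lambda>_. borel) \<Otimes>\<^sub>M Pi\<^sub>M {1..t} (\<lambda>_. borel))"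
    and "\<And>u. u \<ge> 0 \<Longrightarrow> l u \<ge> 1"
    and "summable (\<lambda>j. 1 / l (real (Suc j)))" and "(\<Sum>j. 1 / l (real (Suc j))) \<le> 1"
    and "\<And>u. 0 \<le> u \<Longrightarrow> u \<le> 1 \<Longrightarrow> l u = l 1"
    and "antimono_on {1..} (\<lambda>u. 2 powr (- u) * ln (l u))"
    and "0 < \<delta>" and "\<delta> < 1"
  shows "measure M {\<omega> \<in> space M. \<forall>t\<ge>1.
             sup_risk_deviation P F t (\<lambda>i. (X i \<omega>, Y i \<omega>))
               \<le> rademacher_complexity M \<epsilon> X F (nat \<lceil>real t / 2\<rceil>)
                  + 2 * confidence_width l \<delta> t} \<ge> 1 - \<delta> \<and>
         reverse_submartingale M (exchangeable_algebra M X) (emp_rademacher_complexity M \<epsilon> X F) \<and>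
         measure M {\<omega> \<in> space M. \<forall>t\<ge>1.
             rademacher_complexity M \<epsilon> X F (nat \<lceil>real t / 2\<rceil>)
               \<ge> emp_rademacher_complexity M \<epsilon> X F t \<omega>
                  - 4 * confidence_width l \<delta> t} \<ge> 1 - \<delta>"
proof -
  interpret M: prob_space M by fact
  interpret P: prob_space P by fact
  let ?Z = "\<lambda>i \<omega>. (X i \<omega>, Y i \<omega>)"
  let ?Zs = "\<lambda>\<omega>. \<lambda>i\<in>{1..}. ?Z i \<omega>" and ?Xs = "\<lambda>\<omega>. \<lambda>i\<in>{1..}. X i \<omega>" and ?es = "\<lambda>\<omega>. \<lambda>i\<in>{1..}. \<epsilon> i \<omega>"
  define R where "R = distr M borel (\<epsilon> 1)"
  define D where "D = distr P borel fst"
  have fst_P: "fst \<in> P \<rightarrow>\<^sub>M borel" and snd_P: "snd \<in> borel_measurable P"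
    unfolding measurable_cong_sets[OF assms(3) refl] labelled_borel_def
    by (intro measurable_restrict_space1 borel_measurable_continuous_onI continuous_intros)+
  have space_P: "space P = UNIV \<times> {-1, 1}"
    using sets_eq_imp_space_eq[OF assms(3)] by (simp add: labelled_borel_def space_restrict_space)
  have sets_D: "sets D = sets borel" and sets_R: "sets R = sets borel"
    by (simp_all add: D_def R_def)
  interpret D: prob_space D unfolding D_def using fst_P by (rule P.prob_space_distr)
  have eps: "iid_sequence M R \<epsilon>" "distr R R uminus = R"
    using M.rademacher_iid_sequence[OF assms(6) assms(7)] unfolding R_def by auto
  have eps_meas: "\<epsilon> i \<in> borel_measurable M" if "i \<ge> 1" for i
    using assms(7)[OF that] by (simp add: rademacher_def)
  interpret R: prob_space R unfolding R_def using eps_meas[of 1] by (intro M.prob_space_distr) simp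
  have fst_PD: "fst \<in> P \<rightarrow>\<^sub>M D" using fst_P measurable_cong_sets[OF refl sets_D] by blast
  have data: "iid_sequence M D X"
  proof -
    have "distr P D fst = D" unfolding D_def by (intro distr_cong) auto
    from M.iid_sequence_map[OF assms(4) fst_PD this] show ?thesis by simp
  qed
  note Z_law = M.iid_sequence_law[OF assms(4)] and X_law = M.iid_sequence_law[OF data]
    and e_law = M.iid_sequence_law[OF eps(1)]
  have signs_R: "AE s in R. s = -1 \<or> s = 1"
    unfolding R_def using M.rademacher_AE[OF assms(7)[of 1]] eps_meas[of 1]
    by (subst AE_distr_iff) auto
  have measurable_eq: "Pi\<^sub>M {1..t} (\<lambda>_. borel) \<Otimes>\<^sub>M Pi\<^sub>M {1..t} (\<lambda>_. borel) \<rightarrow>\<^sub>M borel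
      = (Pi\<^sub>M {1..t} (\<lambda>_. R) \<Otimes>\<^sub>M Pi\<^sub>M {1..t} (\<lambda>_. D) \<rightarrow>\<^sub>M (borel :: real measure))" for t :: nat
    using sets_R sets_D by (intro measurable_cong_sets sets_pair_measure_cong sets_PiM_cong) auto
  have values_F: "f u = -1 \<or> f u = 1" if "f \<in> F" for f u
    using assms(5)[OF that] by auto
  have F_meas: "f \<in> borel_measurable D" if "f \<in> F" for f
    using assms(5)[OF that] measurable_cong_sets[OF sets_D refl] by blast
  interpret symmetrization F R D P
  proof unfold_locales
    show "(\<lambda>(e, x). rademacher_sup F t e x) \<in> borel_measurable (Pi\<^sub>M {1..t} (\<lambda>_. R) \<Otimes>\<^sub>M Pi\<^sub>M {1..t} (\<lambda>_. D))"
      if "t \<ge> 1" for t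
      using assms(10)[OF that] unfolding measurable_eq .
    show "snd u = -1 \<or> snd u = 1" if "u \<in> space P" for u
      using that unfolding space_P by auto
    show "space D = UNIV" using sets_eq_imp_space_eq[OF sets_D] by simp
  qed (fact values_F F_meas sets_R signs_R eps(2) fst_PD snd_P assms(9))+
  have mean_eq: "mean_sup t x = (\<integral>\<omega>. rademacher_sup F t (\<lambda>i. \<epsilon> i \<omega>) x \<partial>M)" if t: "t \<ge> 1" for t x
  proof -
    have "mean_sup t x = (\<integral>e. rademacher_sup F t e x \<partial>distr M (iid_space R) ?es)"
      by (simp only: mean_sup_def e_law(2))
    also have "\<dots> = (\<integral>\<omega>. rademacher_sup F t (?es \<omega>) x \<partial>M)"
      by (rule integral_distr[OF e_law(1) measurable_signs[OF t]])
    also have "\<dots> = (\<integral>\<omega>. rademacher_sup F t (\<lambda>i. \<epsilon> i \<omega>) x \<partial>M)"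
      by (intro Bochner_Integration.integral_cong rademacher_sup_cong) auto
    finally show ?thesis .
  qed
  have emp_eq: "emp_rademacher_complexity M \<epsilon> X F t \<omega> = mean_sup t (\<lambda>i. X i \<omega>)" if "t \<ge> 1" for t \<omega>
    by (simp add: emp_rademacher_complexity_def mean_eq[OF that])
  have map_fst: "(\<lambda>z. \<lambda>i\<in>{1..}. fst (z i)) \<in> iid_space P \<rightarrow>\<^sub>M iid_space D"
    by (intro measurable_restrict measurable_compose[OF _ fst_PD] measurable_component_singleton)
  have joint: "distr M (iid_space D \<Otimes>\<^sub>M iid_space R) (\<lambda>\<omega>. (?Xs \<omega>, ?es \<omega>)) = iid_space D \<Otimes>\<^sub>M iid_space R"
  proof -
    have sets_eq: "sets (Pi\<^sub>M {1::nat..} (\<lambda>_. borel)) = sets (iid_space R)"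
      using sets_R by (intro sets_PiM_cong) auto
    have "iid_space D \<Otimes>\<^sub>M iid_space R
        = distr M (iid_space D \<Otimes>\<^sub>M iid_space R) (\<lambda>\<omega>. (?Xs \<omega>, ?es \<omega>))"
    proof (rule pair_measure_eqI)
      fix A B assume A: "A \<in> sets (iid_space D)" and B: "B \<in> sets (iid_space R)"
      let ?A = "?Xs -` A \<inter> space M" and ?B = "?es -` B \<inter> space M"
      \<comment> \<open>Independence is given for the labelled pairs, so an event about the points
        is first pulled back through the projection to an event about the pairs.\<close>
      have "?A = ?Zs -` ((\<lambda>z. \<lambda>i\<in>{1..}. fst (z i)) -` A \<inter> space (iid_space P)) \<inter> space M"
        using measurable_space[OF Z_law(1)] by (auto cong: restrict_cong)
      then have A': "?A \<in> sets (sequence_algebra M P ?Z)"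
        unfolding sequence_algebra_def using measurable_sets[OF map_fst A] by (simp only: in_vimage_algebra)
      have B': "?B \<in> sets (sequence_algebra M borel \<epsilon>)"
        unfolding sequence_algebra_def using B sets_eq by (intro in_vimage_algebra) simp
      have "emeasure (distr M (iid_space D \<Otimes>\<^sub>M iid_space R) (\<lambda>\<omega>. (?Xs \<omega>, ?es \<omega>))) (A \<times> B)
          = emeasure M ((\<lambda>\<omega>. (?Xs \<omega>, ?es \<omega>)) -` (A \<times> B) \<inter> space M)"
        using A B by (intro emeasure_distr measurable_Pair X_law(1) e_law(1)) auto
      also have "(\<lambda>\<omega>. (?Xs \<omega>, ?es \<omega>)) -` (A \<times> B) \<inter> space M = ?A \<inter> ?B" by blast
      also have "emeasure M (?A \<inter> ?B) = emeasure M ?A * emeasure M ?B"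
        using M.indep_setD[OF assms(8) A' B'] by (simp add: M.emeasure_eq_measure ennreal_mult)
      also have "emeasure M ?A = emeasure (iid_space D) A"
        using emeasure_distr[OF X_law(1) A] by (simp only: X_law(2))
      also have "emeasure M ?B = emeasure (iid_space R) B"
        using emeasure_distr[OF e_law(1) B] by (simp only: e_law(2))
      finally show "emeasure (iid_space D) A * emeasure (iid_space R) B
          = emeasure (distr M (iid_space D \<Otimes>\<^sub>M iid_space R) (\<lambda>\<omega>. (?Xs \<omega>, ?es \<omega>))) (A \<times> B)" ..
    qed (auto intro: mean.Q.sigma_finite_measure_axioms QR.sigma_finite_measure_axioms)
    then show ?thesis ..
  qed
  have complexity_eq: "rademacher_complexity M \<epsilon> X F t = (\<integral>x. mean_sup t x \<partial>iid_space D)" if t: "t \<ge> 1" for t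
  proof -
    have "rademacher_complexity M \<epsilon> X F t = (\<integral>\<omega>. (\<lambda>p. rademacher_sup F t (snd p) (fst p)) (?Xs \<omega>, ?es \<omega>) \<partial>M)"
      unfolding rademacher_complexity_def fst_conv snd_conv
      by (intro Bochner_Integration.integral_cong rademacher_sup_cong) auto
    also have "\<dots> = (\<integral>p. rademacher_sup F t (snd p) (fst p)
        \<partial>distr M (iid_space D \<Otimes>\<^sub>M iid_space R) (\<lambda>\<omega>. (?Xs \<omega>, ?es \<omega>)))"
      by (intro integral_distr[symmetric] measurable_Pair X_law(1) e_law(1) measurable_pair_sup t)
    finally show ?thesis unfolding joint by (simp only: integral_rademacher_sup[OF t])
  qed
  have mean_P: "(\<integral>z. mean_sup t (\<lambda>i. fst (z i)) \<partial>iid_space P) = (\<integral>x. mean_sup t x \<partial>iid_space D)" if t: "t \<ge> 1" for t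
  proof -
    \<comment> \<open>The unrestricted projected sequence has the value \<open>fst undefined\<close>
      at index 0 and need not lie in \<open>iid_space D\<close>. Only the first \<open>t\<close>
      values matter, so it may be restricted.\<close>
    have eq: "mean_sup t (\<lambda>i. x i) = mean_sup t (\<lambda>i\<in>{1..}. x i)" for x
      using t by (intro mean.prefix_cong) auto
    have "(\<integral>z. mean_sup t (\<lambda>i. fst (z i)) \<partial>iid_space P)
        = (\<integral>z. mean_sup t (\<lambda>i\<in>{1..}. fst (z i)) \<partial>distr M (iid_space P) ?Zs)"
      unfolding Z_law(2) by (subst eq) simp
    also have "\<dots> = (\<integral>\<omega>. mean_sup t (\<lambda>i\<in>{1..}. fst (?Zs \<omega> i)) \<partial>M)"
      by (rule integral_distr[OF Z_law(1) measurable_compose[OF map_fst mean.measurable_iid[OF t]]])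
    also have "\<dots> = (\<integral>\<omega>. mean_sup t (?Xs \<omega>) \<partial>M)"
      using t by (intro Bochner_Integration.integral_cong mean.prefix_cong) auto
    also have "\<dots> = (\<integral>x. mean_sup t x \<partial>distr M (iid_space D) ?Xs)"
      by (rule integral_distr[OF X_law(1) mean.measurable_iid[OF t], symmetric])
    finally show ?thesis unfolding X_law(2) .
  qed
  let ?m = "\<lambda>t. rademacher_complexity M \<epsilon> X F (nat \<lceil>real t / 2\<rceil>)"
  have mean_le: "(\<integral>x. mean_sup n x \<partial>iid_space D) \<le> ?m t" if "1 \<le> n" "n \<le> t" "t < 2 * n" for n t
  proof -
    \<comment> \<open>From \<open>t < 2 * n\<close> it follows that the ceiling of
      \<open>t / 2\<close> is at most the epoch start \<open>n\<close>, and the complexity is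
      antitone.\<close>
    have "1 \<le> nat \<lceil>real t / 2\<rceil>" "nat \<lceil>real t / 2\<rceil> \<le> n" using that by linarith+
    then show ?thesis using mean.expectation_antimono complexity_eq by simp
  qed
  have deviation_le: "(\<integral>z. sup_risk_deviation P F n z \<partial>iid_space P) \<le> ?m t"
    if "1 \<le> n" "n \<le> t" "t < 2 * n" for n t
    using expected_deviation_le[OF that(1)] mean_P[OF that(1)] mean_le[OF that] by simp
  have 1: "measure M {\<omega> \<in> space M. \<forall>t\<ge>1. sup_risk_deviation P F t (\<lambda>i. ?Z i \<omega>)
      \<le> ?m t + 2 * confidence_width l \<delta> t} \<ge> 1 - \<delta>"
    using deviation.confidence_sequence[of 1 ?m l \<delta>, OF _ deviation_bounded_difference deviation_le assms(11-17)]
    unfolding deviation.transfer_confidence[OF Z_law] by simp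
  have 2: "reverse_submartingale M (exchangeable_algebra M X) (emp_rademacher_complexity M \<epsilon> X F)"
  proof -
    have "reverse_submartingale M (exchangeable_algebra M X) (\<lambda>t \<omega>. mean_sup t (\<lambda>i. X i \<omega>))"
      by (rule reverse_submartingale_exchangeable[OF mean.leave_one_out_axioms assms(1) sets_D X_law])
    moreover have "emp_rademacher_complexity M \<epsilon> X F t = (\<lambda>\<omega>. mean_sup t (\<lambda>i. X i \<omega>))" if "t \<ge> 1" for t
      using emp_eq[OF that] by auto
    ultimately show ?thesis by (simp add: reverse_submartingale_def)
  qed
  \<comment> \<open>Here the bounded difference constant is \<open>c = 2\<close>, so the margin
    \<open>2 * c\<close> is the factor 4 of the claim; the deviation above has
    \<open>c = 1\<close>.\<close>
  have 3: "measure M {\<omega> \<in> space M. \<forall>t\<ge>1. mean_sup t (\<lambda>i. X i \<omega>)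
      \<le> ?m t + 2 * 2 * confidence_width l \<delta> t} \<ge> 1 - \<delta>"
    using mean.confidence_sequence[of 2 ?m l \<delta>, OF _ mean_sup_bounded_difference mean_le assms(11-17)]
    unfolding mean.transfer_confidence[OF X_law] by simp
  have "{\<omega> \<in> space M. \<forall>t\<ge>1. mean_sup t (\<lambda>i. X i \<omega>) \<le> ?m t + 2 * 2 * confidence_width l \<delta> t}
      = {\<omega> \<in> space M. \<forall>t\<ge>1. ?m t \<ge> emp_rademacher_complexity M \<epsilon> X F t \<omega> - 4 * confidence_width l \<delta> t}"
    by (auto simp: emp_eq algebra_simps)
  with 1 2 3 show ?thesis by simp
qed

end
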